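(* Let $\alpha$ be a composition, $T\in\mathbf B(\alpha)$ a quasi-ribbon tableau and $b\in\mathcal N$. Then $(b\rightarrow T)\simeq T\otimes b$, i.e. the quasi-ribbon tableau $b\to T$ obtained by inserting $b$ into $T$ is $\mathfrak{gl}_{\mathcal N}$-equivalent to $T\otimes b\in\mathbf B(\alpha)\otimes\mathcal N$.
   Context: $\mathcal N=\frac12\mathbb Z_{>0}$ with its usual linear order; elements of $\mathbb Z_{>0}$ are even, elements of $\frac12+\mathbb Z_{\ge0}$ are odd. $I=\frac12\mathbb Z_{>0}$. $P=\bigoplus_{b\in\mathcal N}\mathbb Z\epsilon_b$ with symmetric bilinear form $(\epsilon_a,\epsilon_b)=(-1)^{|a|}\delta_{ab}$ ($|a|$ the parity). Simple roots: $\alpha_i=\epsilon_i-\epsilon_{i+\frac12}$, $i\in I$. A $\mathfrak{gl}_{\mathcal N}$-crystal is a set $B$ with maps $\mathrm{wt}:B\to P$, $\varepsilon_i,\varphi_i:B\to\mathbb Z_{\ge0}$, $e_i,f_i:B\to B\cup\{\mathbf 0\}$ ($i\in I$; $\mathbf 0$ a formal symbol) such that: (1) $\varphi_i(b)+\varepsilon_i(b)$ is $1$ if $(\mathrm{wt}(b),\alpha_i)\ne0$ and $0$ otherwise; (2) if $e_ib\in B$ then $\varepsilon_i(e_ib)=\varepsilon_i(b)-1$, $\varphi_i(e_ib)=\varphi_i(b)+1$, $\mathrm{wt}(e_ib)=\mathrm{wt}(b)+\alpha_i$; (3) if $f_ib\in B$ then $\varepsilon_i(f_ib)=\varepsilon_i(b)+1$,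 $\varphi_i(f_ib)=\varphi_i(b)-1$, $\mathrm{wt}(f_ib)=\mathrm{wt}(b)-\alpha_i$; (4) $f_ib=b'$ iff $b=e_ib'$. It is viewed as an $I$-colored oriented graph ($b\xrightarrow{i}b'$ iff $b'=f_ib$). An isomorphism of crystals is an isomorphism of colored oriented graphs preserving $\mathrm{wt},\varepsilon_i,\varphi_i$. $C(b)$ denotes the connected component of $b$. For $b_1\in B_1$, $b_2\in B_2$, $b_1$ and $b_2$ are $\mathfrak{gl}_{\mathcal N}$-equivalent, $b_1\simeq b_2$, if there is a crystal isomorphism $C(b_1)\to C(b_2)$ sending $b_1$ to $b_2$. Tensor product $B_1\otimes B_2=\{b_1\otimes b_2\}$: $\mathrm{wt}(b_1\otimes b_2)=\mathrm{wt}(b_1)+\mathrm{wt}(b_2)$. For $i\in\mathbb Z_{>0}$: $x_i(b_1\otimes b_2)=x_ib_1\otimes b_2$ if $(\alpha_i,\mathrm{wt}(b_1))\neq0$ and $b_1\otimes x_ib_2$ otherwise. For $i\in\frac12+\mathbb Z_{\ge0}$: $x_i(b_1\otimes b_2)=b_1\otimes x_ib_2$ if $(\alpha_i,\mathrm{wt}(b_2))\ne0$ and $x_ib_1\otimes b_2$ otherwise ($x=e,f$; $\mathbf 0\otimes b_2=b_1\otimes\mathbf 0=\mathbf 0$). $\varepsilon_i,\varphi_i$ of $b_1\otimes b_2$ are those of the factor acted on. $\mathcal N$ itself is a crystal with $\mathrm{wt}(b)=\epsilon_b$, $f_i(i)=i+\frac12$, $e_i(i+\frac12)=i$, all other $e_i,f_i$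 giving $\mathbf 0$, and $\varepsilon_i(b)$ (resp. $\varphi_i(b)$) equal to $1$ if $e_ib\ne\mathbf 0$ (resp. $f_ib\neq\mathbf 0$), else $0$. A word $w_1\cdots w_r$ in $\mathcal N$ is identified with $w_1\otimes\cdots\otimes w_r$. A composition $\alpha=(\alpha_1,\dots,\alpha_t)$ is identified with its ribbon diagram: rows from top to bottom have $\alpha_1,\dots,\alpha_t$ nodes, and the leftmost node of row $i+1$ is directly below the rightmost node of row $i$. A quasi-ribbon tableau of shape $\alpha$ is a filling with entries in $\mathcal N$ weakly increasing along rows (left to right) and columns (top to bottom), with integers strictly increasing in each column and odd half-integers strictly increasing in each row; $\mathbf B(\alpha)$ is the set of these. $w(T)$ is the word obtained by reading rows from top to bottom, each row from right to left; $\mathbf B(\alpha)$ is a $\mathfrak{gl}_{\mathcal N}$-crystal by identifying $T$ with $w(T)$. Insertion: let $t_1,t_2,\dots$ be the entries of $T$ read from northwest to southeast along the ribbon. Given $b\in\mathcal N$, let $k$ be the smallest index with $b\le t_k$ if $b\in\mathbb Z_{>0}$, resp. $b<t_k$ if $b\in\frac12+\mathbb Z_{\ge0}$ (if there is none, $k-1$ is the number of nodes of $T$). Then $b\to T$ is the quasi-ribbon tableau obtained by gluing the sub-tableau $T^{\le k-1}$ of the first $k-1$ nodes, the node $b$, and the sub-tableau $T^{\ge k}$ of the remaining nodes, where $b$ is placed directly below the last node of $T^{\le k-1}$ and directly to the left of the first node of $T^{\ge k}$. *)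

theory Defs
  imports Complex_Main "HOL-Library.Poly_Mapping"
begin

text \<open>
  The set of positive half-integers serves both as the alphabet \<open>\<N>\<close> and as the index set \<open>I\<close>.
\<close>

typedef pos_half = "{q :: rat. \<exists>n :: nat. 0 < n \<and> q = of_nat n / 2}"
  morphisms rat_of_half half_of_rat
  by (rule exI[of _ "of_nat 1 / 2"]) blast

setup_lifting type_definition_pos_half

instantiation pos_half :: linorder
begin
lift_definition less_eq_pos_half :: "pos_half \<Rightarrow> pos_half \<Rightarrow> bool" is "(\<le>)" .
lift_definition less_pos_half :: "pos_half \<Rightarrow> pos_half \<Rightarrow> bool" is "(<)" .
instance by standard (transfer; force)+
end

definition is_integer :: "pos_half \<Rightarrow> bool"
  where "is_integer a \<longleftrightarrow> rat_of_half a \<in> \<int>"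

definition parity :: "pos_half \<Rightarrow> nat"
  where "parity a = (if is_integer a then 0 else 1)"

lift_definition plus_half :: "pos_half \<Rightarrow> pos_half" is "\<lambda>q. q + 1 / 2"
proof -
  fix q :: rat assume "\<exists>n :: nat. 0 < n \<and> q = of_nat n / 2"
  then obtain n :: nat where "q = of_nat n / 2" by blast
  then have "0 < Suc n \<and> q + 1 / 2 = of_nat (Suc n) / 2" by simp
  then show "\<exists>n :: nat. 0 < n \<and> q + 1 / 2 = of_nat n / 2" by blast
qed


section \<open>Weights\<close>

type_synonym weight = "pos_half \<Rightarrow>\<^sub>0 int"

abbreviation epsilon :: "pos_half \<Rightarrow> weight"
  where "epsilon b \<equiv> Poly_Mapping.single b 1"

definition form :: "weight \<Rightarrow> weight \<Rightarrow> int"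
  where "form x y =
    (\<Sum>a\<in>Poly_Mapping.keys x. (- 1) ^ parity a * Poly_Mapping.lookup x a * Poly_Mapping.lookup y a)"

definition simple_root :: "pos_half \<Rightarrow> weight"
  where "simple_root i = epsilon i - epsilon (plus_half i)"


section \<open>Crystals\<close>

text \<open>
  The formal symbol \<open>\<zero>\<close> is rendered by \<^const>\<open>None\<close>.  The record holds the raw data; all fields
  are relevant on \<open>vertices\<close> only, and the axioms are collected in \<open>gl_crystal\<close>.
\<close>

record 'b crystal =
  vertices :: "'b set"
  wt :: "'b \<Rightarrow> weight"
  eps :: "pos_half \<Rightarrow> 'b \<Rightarrow> nat"
  phi :: "pos_half \<Rightarrow> 'b \<Rightarrow> nat"
  e_op :: "pos_half \<Rightarrow> 'b \<Rightarrow> 'b option"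
  f_op :: "pos_half \<Rightarrow> 'b \<Rightarrow> 'b option"

definition gl_crystal :: "'b crystal \<Rightarrow> bool"
  where "gl_crystal B \<longleftrightarrow> (\<forall>i. \<forall>b\<in>vertices B.
     (\<forall>b'. e_op B i b = Some b' \<longrightarrow> b' \<in> vertices B) \<and>
     (\<forall>b'. f_op B i b = Some b' \<longrightarrow> b' \<in> vertices B) \<and>
     phi B i b + eps B i b = (if form (wt B b) (simple_root i) \<noteq> 0 then 1 else 0) \<and>
     (\<forall>b'. e_op B i b = Some b' \<longrightarrow>
        int (eps B i b') = int (eps B i b) - 1 \<and>
        int (phi B i b') = int (phi B i b) + 1 \<and>
        wt B b' = wt B b + simple_root i) \<and>
     (\<forall>b'. f_op B i b = Some b' \<longrightarrow>
        int (eps B i b') = int (eps B i b) + 1 \<and>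
        int (phi B i b') = int (phi B i b) - 1 \<and>
        wt B b' = wt B b - simple_root i) \<and>
     (\<forall>b'\<in>vertices B. f_op B i b = Some b' \<longleftrightarrow> e_op B i b' = Some b))"

definition arrows :: "'b crystal \<Rightarrow> ('b \<times> 'b) set"
  where "arrows B =
    {(b, b'). b \<in> vertices B \<and> b' \<in> vertices B \<and> (\<exists>i. f_op B i b = Some b')}"

definition component :: "'b crystal \<Rightarrow> 'b \<Rightarrow> 'b set"
  where "component B b = {b'. (b, b') \<in> (arrows B \<union> (arrows B)\<inverse>)\<^sup>*}"

definition component_iso ::
    "'b crystal \<Rightarrow> 'b \<Rightarrow> 'c crystal \<Rightarrow> 'c \<Rightarrow> ('b \<Rightarrow> 'c) \<Rightarrow> bool"
  where "component_iso B1 b1 B2 b2 \<psi> \<longleftrightarrow>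
     bij_betw \<psi> (component B1 b1) (component B2 b2) \<and>
     (\<forall>i. \<forall>b\<in>component B1 b1. \<forall>b'\<in>component B1 b1.
        f_op B1 i b = Some b' \<longleftrightarrow> f_op B2 i (\<psi> b) = Some (\<psi> b')) \<and>
     (\<forall>b\<in>component B1 b1. wt B2 (\<psi> b) = wt B1 b) \<and>
     (\<forall>i. \<forall>b\<in>component B1 b1. eps B2 i (\<psi> b) = eps B1 i b \<and> phi B2 i (\<psi> b) = phi B1 i b)"

definition gl_equiv :: "'b crystal \<Rightarrow> 'b \<Rightarrow> 'c crystal \<Rightarrow> 'c \<Rightarrow> bool"
  where "gl_equiv B1 b1 B2 b2 \<longleftrightarrow>
     gl_crystal B1 \<and> gl_crystal B2 \<and> b1 \<in> vertices B1 \<and> b2 \<in> vertices B2 \<and>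
     (\<exists>\<psi>. component_iso B1 b1 B2 b2 \<psi> \<and> \<psi> b1 = b2)"

definition acts_on_left :: "'b crystal \<Rightarrow> 'c crystal \<Rightarrow> pos_half \<Rightarrow> 'b \<Rightarrow> 'c \<Rightarrow> bool"
  where "acts_on_left B1 B2 i b1 b2 \<longleftrightarrow>
    (if is_integer i then form (simple_root i) (wt B1 b1) \<noteq> 0
     else form (simple_root i) (wt B2 b2) = 0)"

definition tensor :: "'b crystal \<Rightarrow> 'c crystal \<Rightarrow> ('b \<times> 'c) crystal"
  where "tensor B1 B2 =
    \<lparr> vertices = vertices B1 \<times> vertices B2,
      wt = (\<lambda>(b1, b2). wt B1 b1 + wt B2 b2),
      eps = (\<lambda>i (b1, b2). if acts_on_left B1 B2 i b1 b2 then eps B1 i b1 else eps B2 i b2),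
      phi = (\<lambda>i (b1, b2). if acts_on_left B1 B2 i b1 b2 then phi B1 i b1 else phi B2 i b2),
      e_op = (\<lambda>i (b1, b2). if acts_on_left B1 B2 i b1 b2
                then map_option (\<lambda>b1'. (b1', b2)) (e_op B1 i b1)
                else map_option (\<lambda>b2'. (b1, b2')) (e_op B2 i b2)),
      f_op = (\<lambda>i (b1, b2). if acts_on_left B1 B2 i b1 b2
                then map_option (\<lambda>b1'. (b1', b2)) (f_op B1 i b1)
                else map_option (\<lambda>b2'. (b1, b2')) (f_op B2 i b2)) \<rparr>"

text \<open>
  The structure that a set \<open>A\<close> acquires when its elements are identified with vertices of \<open>B\<close> via a
  map \<open>g\<close>.  It is meant for \<open>g\<close> injective on \<open>A\<close> and \<open>g ` A\<close> stable under all \<open>e_op B i\<close>,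
  \<open>f_op B i\<close>; see \<open>gl_crystal_identify\<close> and its uses below.
\<close>

definition identify :: "'a set \<Rightarrow> ('a \<Rightarrow> 'b) \<Rightarrow> 'b crystal \<Rightarrow> 'a crystal"
  where "identify A g B =
    \<lparr> vertices = A,
      wt = (\<lambda>a. wt B (g a)),
      eps = (\<lambda>i a. eps B i (g a)),
      phi = (\<lambda>i a. phi B i (g a)),
      e_op = (\<lambda>i a. map_option (inv_into A g) (e_op B i (g a))),
      f_op = (\<lambda>i a. map_option (inv_into A g) (f_op B i (g a))) \<rparr>"

definition letter_crystal :: "pos_half crystal"
  where "letter_crystal =
    \<lparr> vertices = UNIV,
      wt = epsilon,
      eps = (\<lambda>i b. if b = plus_half i then 1 else 0),
      phi = (\<lambda>i b. if b = i then 1 else 0),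
      e_op = (\<lambda>i b. if b = plus_half i then Some i else None),
      f_op = (\<lambda>i b. if b = i then Some (plus_half i) else None) \<rparr>"

definition empty_word_crystal :: "pos_half list crystal"
  where "empty_word_crystal =
    \<lparr> vertices = {[]}, wt = (\<lambda>_. 0), eps = (\<lambda>_ _. 0), phi = (\<lambda>_ _. 0),
      e_op = (\<lambda>_ _. None), f_op = (\<lambda>_ _. None) \<rparr>"

text \<open>Words of length \<open>r\<close>: the \<open>r\<close>-fold tensor power of the alphabet, bracketed to the right.\<close>

primrec word_crystal :: "nat \<Rightarrow> pos_half list crystal"
  where
    "word_crystal 0 = empty_word_crystal"
  | "word_crystal (Suc r) =
       identify {w. length w = Suc r} (\<lambda>w. (hd w, tl w)) (tensor letter_crystal (word_crystal r))"


section \<open>Quasi-ribbon tableaux\<close>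

text \<open>
  A filling of the ribbon of a composition \<open>\<alpha>\<close> is the list of its rows, from top to bottom, each
  row being read from left to right.  In a ribbon two vertically adjacent nodes are always the last
  node of a row and the first node of the next row, and a column is a run of such pairs.  Both
  relations below are transitive, so it is enough to impose the second one on adjacent nodes.
\<close>

type_synonym tableau = "pos_half list list"

definition composition :: "nat list \<Rightarrow> bool"
  where "composition \<alpha> \<longleftrightarrow> (\<forall>a\<in>set \<alpha>. 0 < a)"

definition row_rel :: "pos_half \<Rightarrow> pos_half \<Rightarrow> bool"
  where "row_rel a b \<longleftrightarrow> a < b \<or> (a = b \<and> is_integer a)"

definition col_rel :: "pos_half \<Rightarrow> pos_half \<Rightarrow> bool"
  where "col_rel a b \<longleftrightarrow> a < b \<or> (a = b \<and> \<not> is_integer a)"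

definition quasi_ribbon_tableaux :: "nat list \<Rightarrow> tableau set"
  where "quasi_ribbon_tableaux \<alpha> =
    {T. composition \<alpha> \<and> map length T = \<alpha> \<and>
        (\<forall>r\<in>set T. sorted_wrt row_rel r) \<and>
        (\<forall>k. Suc k < length T \<longrightarrow> col_rel (last (T ! k)) (hd (T ! Suc k)))}"

definition reading_word :: "tableau \<Rightarrow> pos_half list"
  where "reading_word T = concat (map rev T)"

definition tableau_crystal :: "nat list \<Rightarrow> tableau crystal"
  where "tableau_crystal \<alpha> =
    identify (quasi_ribbon_tableaux \<alpha>) reading_word (word_crystal (sum_list \<alpha>))"


section \<open>Insertion\<close>

text \<open>
  \<open>take_nodes p T\<close> and \<open>drop_nodes p T\<close> are the sub-tableaux formed by the first \<open>p\<close> nodes along the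
  ribbon and by the remaining ones.
\<close>

fun take_nodes :: "nat \<Rightarrow> tableau \<Rightarrow> tableau"
  where
    "take_nodes p [] = []"
  | "take_nodes p (r # T) =
       (if p = 0 then [] else if p \<le> length r then [take p r]
        else r # take_nodes (p - length r) T)"

fun drop_nodes :: "nat \<Rightarrow> tableau \<Rightarrow> tableau"
  where
    "drop_nodes p [] = []"
  | "drop_nodes p (r # T) =
       (if p < length r then drop p r # T else drop_nodes (p - length r) T)"

definition bumps :: "pos_half \<Rightarrow> pos_half \<Rightarrow> bool"
  where "bumps b t \<longleftrightarrow> (if is_integer b then b \<le> t else b < t)"

text \<open>The number of entries of \<open>T\<close> preceding the inserted letter, i.e. \<open>k - 1\<close>.\<close>

definition insertion_point :: "pos_half \<Rightarrow> tableau \<Rightarrow> nat"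
  where "insertion_point b T =
    (let t = concat T in
     if \<exists>k < length t. bumps b (t ! k) then LEAST k. k < length t \<and> bumps b (t ! k)
     else length t)"

text \<open>
  Gluing: the new node opens a new row (it lies below the last node of the first part) which
  continues with the first row of the second part.
\<close>

definition glue :: "tableau \<Rightarrow> pos_half \<Rightarrow> tableau \<Rightarrow> tableau"
  where "glue T1 b T2 =
    (case T2 of [] \<Rightarrow> T1 @ [[b]] | r # T2' \<Rightarrow> T1 @ [b # r] @ T2')"

definition insert_letter :: "pos_half \<Rightarrow> tableau \<Rightarrow> tableau"
  where "insert_letter b T =
    (let p = insertion_point b T in glue (take_nodes p T) b (drop_nodes p T))"

definition shape :: "tableau \<Rightarrow> nat list"
  where "shape T = map length T"


section \<open>Well-definedness of the crystals\<close>

lemma half_cases: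
  obtains n :: nat where "0 < n" "rat_of_half a = of_nat n / 2"
  using rat_of_half[of a] by blast

lemma rat_of_nat_half_Ints: "(of_nat n / 2 :: rat) \<in> \<int> \<longleftrightarrow> even n"
proof
  assume "(of_nat n / 2 :: rat) \<in> \<int>"
  then obtain k :: int where "(of_nat n / 2 :: rat) = of_int k" by (auto elim: Ints_cases)
  then have "(of_int (int n) :: rat) = of_int (2 * k)" by simp
  then have "int n = 2 * k" by (simp only: of_int_eq_iff)
  then show "even n" by presburger
next
  assume "even n"
  then obtain k where "n = 2 * k" by blast
  then have "(of_nat n / 2 :: rat) = of_nat k" by simp
  then show "(of_nat n / 2 :: rat) \<in> \<int>" by simp
qed

lemma is_integer_plus_half [simp]: "is_integer (plus_half a) \<longleftrightarrow> \<not> is_integer a"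
proof -
  obtain n :: nat where n: "rat_of_half a = of_nat n / 2" by (rule half_cases)
  have "rat_of_half (plus_half a) = of_nat (Suc n) / 2"
    using n by (simp add: plus_half.rep_eq add_divide_distrib)
  with n show ?thesis by (simp only: is_integer_def rat_of_nat_half_Ints even_Suc)
qed

lemma less_plus_half [simp]: "a < plus_half a"
  by transfer simp

lemma plus_half_neq [simp]: "plus_half a \<noteq> a" "a \<noteq> plus_half a"
  using less_plus_half[of a] by (metis less_irrefl)+

lemma plus_half_le_iff: "plus_half a \<le> b \<longleftrightarrow> a < b"
proof -
  obtain m :: nat where m: "rat_of_half a = of_nat m / 2" by (rule half_cases)
  obtain n :: nat where n: "rat_of_half b = of_nat n / 2" by (rule half_cases)
  have "plus_half a \<le> b \<longleftrightarrow> (of_nat m / 2 + 1 / 2 :: rat) \<le> of_nat n / 2"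
    unfolding less_eq_pos_half.rep_eq plus_half.rep_eq m n ..
  also have "(of_nat m / 2 + 1 / 2 :: rat) = of_nat (Suc m) / 2"
    by (simp add: add_divide_distrib)
  also have "of_nat (Suc m) / 2 \<le> (of_nat n / 2 :: rat) \<longleftrightarrow> (of_nat (Suc m) :: rat) \<le> of_nat n"
    by (rule divide_le_cancel[THEN trans]) simp
  also have "\<dots> \<longleftrightarrow> m < n" by (simp only: of_nat_le_iff Suc_le_eq)
  also have "\<dots> \<longleftrightarrow> a < b" unfolding less_pos_half.rep_eq m n by (simp add: divide_less_cancel)
  finally show ?thesis .
qed

lemma less_plus_half_iff: "b < plus_half a \<longleftrightarrow> b \<le> a"
  using plus_half_le_iff[of a b] by (auto simp: not_le[symmetric])

lemma form_expand:
  assumes "finite S" "Poly_Mapping.keys x \<subseteq> S"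
  shows "form x y =
    (\<Sum>a\<in>S. (- 1) ^ parity a * Poly_Mapping.lookup x a * Poly_Mapping.lookup y a)"
  unfolding form_def
  by (rule sum.mono_neutral_left) (use assms in \<open>auto simp: in_keys_iff\<close>)

lemma form_sym: "form x y = form y x"
proof -
  let ?S = "Poly_Mapping.keys x \<union> Poly_Mapping.keys y"
  have "form x y = (\<Sum>a\<in>?S. (- 1) ^ parity a * Poly_Mapping.lookup x a * Poly_Mapping.lookup y a)"
    by (rule form_expand) auto
  also have "\<dots> = (\<Sum>a\<in>?S. (- 1) ^ parity a * Poly_Mapping.lookup y a * Poly_Mapping.lookup x a)"
    by (simp add: mult_ac)
  also have "\<dots> = form y x"
    by (rule form_expand[symmetric]) auto
  finally show ?thesis .
qed

lemma form_simple_root: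
  "form x (simple_root i) =
    (- 1) ^ parity i * (Poly_Mapping.lookup x i + Poly_Mapping.lookup x (plus_half i))"
proof -
  let ?S = "{i, plus_half i}"
  have "form (simple_root i) x = (\<Sum>a\<in>?S. (- 1) ^ parity a *
          Poly_Mapping.lookup (simple_root i) a * Poly_Mapping.lookup x a)"
    by (rule form_expand) (auto simp: simple_root_def in_keys_iff lookup_minus lookup_single when_def
        split: if_splits)
  also have "\<dots> = (- 1) ^ parity i * Poly_Mapping.lookup x i
      - (- 1) ^ parity (plus_half i) * Poly_Mapping.lookup x (plus_half i)"
    by (simp add: simple_root_def lookup_minus lookup_single)
  also have "\<dots> = (- 1) ^ parity i * (Poly_Mapping.lookup x i + Poly_Mapping.lookup x (plus_half i))"
    by (simp add: parity_def)
  finally show ?thesis by (simp add: form_sym)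
qed

lemma form_simple_root_eq_0_iff:
  "form x (simple_root i) = 0 \<longleftrightarrow>
     Poly_Mapping.lookup x i + Poly_Mapping.lookup x (plus_half i) = 0"
  by (simp add: form_simple_root)

lemma form_simple_root_shift:
  "form (x + simple_root i) (simple_root i) = form x (simple_root i)"
  "form (x - simple_root i) (simple_root i) = form x (simple_root i)"
  unfolding form_simple_root by (simp_all add: simple_root_def lookup_add lookup_minus lookup_single)

definition nonneg_weights :: "'b crystal \<Rightarrow> bool"
  where "nonneg_weights B \<longleftrightarrow> (\<forall>b\<in>vertices B. \<forall>a. 0 \<le> Poly_Mapping.lookup (wt B b) a)"

lemma gl_crystalD:
  assumes "gl_crystal B" "b \<in> vertices B"
  shows "e_op B i b = Some b' \<Longrightarrow> b' \<in> vertices B"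
    and "f_op B i b = Some b' \<Longrightarrow> b' \<in> vertices B"
    and "phi B i b + eps B i b = (if form (wt B b) (simple_root i) \<noteq> 0 then 1 else 0)"
    and "e_op B i b = Some b' \<Longrightarrow> int (eps B i b') = int (eps B i b) - 1"
    and "e_op B i b = Some b' \<Longrightarrow> int (phi B i b') = int (phi B i b) + 1"
    and "e_op B i b = Some b' \<Longrightarrow> wt B b' = wt B b + simple_root i"
    and "f_op B i b = Some b' \<Longrightarrow> int (eps B i b') = int (eps B i b) + 1"
    and "f_op B i b = Some b' \<Longrightarrow> int (phi B i b') = int (phi B i b) - 1"
    and "f_op B i b = Some b' \<Longrightarrow> wt B b' = wt B b - simple_root i"
    and "b' \<in> vertices B \<Longrightarrow> f_op B i b = Some b' \<longleftrightarrow> e_op B i b' = Some b"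
  using assms unfolding gl_crystal_def by blast+

lemma gl_crystal_letter: "gl_crystal letter_crystal"
  unfolding gl_crystal_def form_simple_root_eq_0_iff
  by (auto simp: letter_crystal_def simple_root_def lookup_single when_def split: if_splits)

lemma nonneg_letter: "nonneg_weights letter_crystal"
  by (auto simp: nonneg_weights_def letter_crystal_def lookup_single when_def)

lemma gl_crystal_empty_word: "gl_crystal empty_word_crystal"
  by (auto simp: gl_crystal_def empty_word_crystal_def form_def)

lemma nonneg_empty_word: "nonneg_weights empty_word_crystal"
  by (auto simp: nonneg_weights_def empty_word_crystal_def)

lemma form_tensor_eq_0_iff:
  assumes "nonneg_weights B1" "nonneg_weights B2" "b1 \<in> vertices B1" "b2 \<in> vertices B2"
  shows "form (wt B1 b1 + wt B2 b2) (simple_root i) = 0 \<longleftrightarrow>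
    form (wt B1 b1) (simple_root i) = 0 \<and> form (wt B2 b2) (simple_root i) = 0"
proof -
  have "0 \<le> Poly_Mapping.lookup (wt B1 b1) a" "0 \<le> Poly_Mapping.lookup (wt B2 b2) a" for a
    using assms by (auto simp: nonneg_weights_def)
  from this[of i] this[of "plus_half i"] show ?thesis
    by (simp add: form_simple_root_eq_0_iff lookup_add) linarith
qed

lemma nonneg_tensor:
  assumes "nonneg_weights B1" "nonneg_weights B2"
  shows "nonneg_weights (tensor B1 B2)"
  using assms by (auto simp: nonneg_weights_def tensor_def lookup_add)

lemma acts_on_left_iff:
  "acts_on_left B1 B2 i b1 b2 \<longleftrightarrow>
    (if is_integer i then form (wt B1 b1) (simple_root i) \<noteq> 0
     else form (wt B2 b2) (simple_root i) = 0)"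
  unfolding acts_on_left_def form_sym[of "simple_root i"] ..

lemma gl_crystal_tensor:
  assumes B1: "gl_crystal B1" "nonneg_weights B1" and B2: "gl_crystal B2" "nonneg_weights B2"
  shows "gl_crystal (tensor B1 B2)"
  unfolding gl_crystal_def
proof (intro allI ballI)
  fix i and b assume "b \<in> vertices (tensor B1 B2)"
  then obtain b1 b2 where b: "b = (b1, b2)" "b1 \<in> vertices B1" "b2 \<in> vertices B2"
    by (auto simp: tensor_def)
  note D1 = gl_crystalD[OF B1(1)] and D2 = gl_crystalD[OF B2(1)]
  note zero = form_tensor_eq_0_iff[OF B1(2) B2(2) b(2,3)]
  let ?T = "tensor B1 B2"
  have sh1: "form (wt B1 c') (simple_root i) = form (wt B1 c) (simple_root i)"
    if "c \<in> vertices B1" "e_op B1 i c = Some c' \<or> f_op B1 i c = Some c'" for c c'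
    using that(2)
  proof
    assume e: "e_op B1 i c = Some c'"
    show ?thesis unfolding D1(6)[OF that(1) e] by (rule form_simple_root_shift)
  next
    assume f: "f_op B1 i c = Some c'"
    show ?thesis unfolding D1(9)[OF that(1) f] by (rule form_simple_root_shift)
  qed
  have sh2: "form (wt B2 c') (simple_root i) = form (wt B2 c) (simple_root i)"
    if "c \<in> vertices B2" "e_op B2 i c = Some c' \<or> f_op B2 i c = Some c'" for c c'
    using that(2)
  proof
    assume e: "e_op B2 i c = Some c'"
    show ?thesis unfolding D2(6)[OF that(1) e] by (rule form_simple_root_shift)
  next
    assume f: "f_op B2 i c = Some c'"
    show ?thesis unfolding D2(9)[OF that(1) f] by (rule form_simple_root_shift)
  qed
  show "(\<forall>b'. e_op ?T i b = Some b' \<longrightarrow> b' \<in> vertices ?T) \<and>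
     (\<forall>b'. f_op ?T i b = Some b' \<longrightarrow> b' \<in> vertices ?T) \<and>
     phi ?T i b + eps ?T i b = (if form (wt ?T b) (simple_root i) \<noteq> 0 then 1 else 0) \<and>
     (\<forall>b'. e_op ?T i b = Some b' \<longrightarrow>
        int (eps ?T i b') = int (eps ?T i b) - 1 \<and>
        int (phi ?T i b') = int (phi ?T i b) + 1 \<and>
        wt ?T b' = wt ?T b + simple_root i) \<and>
     (\<forall>b'. f_op ?T i b = Some b' \<longrightarrow>
        int (eps ?T i b') = int (eps ?T i b) + 1 \<and>
        int (phi ?T i b') = int (phi ?T i b) - 1 \<and>
        wt ?T b' = wt ?T b - simple_root i) \<and>
     (\<forall>b'\<in>vertices ?T. f_op ?T i b = Some b' \<longleftrightarrow> e_op ?T i b' = Some b)"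
  proof (intro conjI)
    show "\<forall>b'. e_op ?T i b = Some b' \<longrightarrow> b' \<in> vertices ?T"
      using b D1(1)[OF b(2)] D2(1)[OF b(3)] by (auto simp: tensor_def split: if_splits)
    show "\<forall>b'. f_op ?T i b = Some b' \<longrightarrow> b' \<in> vertices ?T"
      using b D1(2)[OF b(2)] D2(2)[OF b(3)] by (auto simp: tensor_def split: if_splits)
    show "phi ?T i b + eps ?T i b = (if form (wt ?T b) (simple_root i) \<noteq> 0 then 1 else 0)"
      using zero D1(3)[OF b(2), of i] D2(3)[OF b(3), of i]
      by (auto simp: b(1) tensor_def acts_on_left_iff split: if_splits)
    show "\<forall>b'. e_op ?T i b = Some b' \<longrightarrow>
        int (eps ?T i b') = int (eps ?T i b) - 1 \<and>
        int (phi ?T i b') = int (phi ?T i b) + 1 \<and>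
        wt ?T b' = wt ?T b + simple_root i"
    proof (intro allI impI)
      fix b' assume e: "e_op ?T i b = Some b'"
      show "int (eps ?T i b') = int (eps ?T i b) - 1 \<and>
        int (phi ?T i b') = int (phi ?T i b) + 1 \<and>
        wt ?T b' = wt ?T b + simple_root i"
      proof (cases "acts_on_left B1 B2 i b1 b2")
        case True
        with e obtain c where c: "b' = (c, b2)" "e_op B1 i b1 = Some c"
          by (auto simp: b(1) tensor_def)
        have "acts_on_left B1 B2 i c b2"
          using True sh1[OF b(2) disjI1[OF c(2)]]
            by (simp add: acts_on_left_iff split: if_splits)
        with True c D1(4-6)[OF b(2) c(2)] show ?thesis by (simp add: b(1) tensor_def algebra_simps)
      next
        case False
        with e obtain c where c: "b' = (b1, c)" "e_op B2 i b2 = Some c"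
          by (auto simp: b(1) tensor_def)
        have "\<not> acts_on_left B1 B2 i b1 c"
          using False sh2[OF b(3) disjI1[OF c(2)]]
            by (simp add: acts_on_left_iff split: if_splits)
        with False c D2(4-6)[OF b(3) c(2)] show ?thesis by (simp add: b(1) tensor_def algebra_simps)
      qed
    qed
    show "\<forall>b'. f_op ?T i b = Some b' \<longrightarrow>
        int (eps ?T i b') = int (eps ?T i b) + 1 \<and>
        int (phi ?T i b') = int (phi ?T i b) - 1 \<and>
        wt ?T b' = wt ?T b - simple_root i"
    proof (intro allI impI)
      fix b' assume f: "f_op ?T i b = Some b'"
      show "int (eps ?T i b') = int (eps ?T i b) + 1 \<and>
        int (phi ?T i b') = int (phi ?T i b) - 1 \<and>
        wt ?T b' = wt ?T b - simple_root i"
      proof (cases "acts_on_left B1 B2 i b1 b2")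
        case True
        with f obtain c where c: "b' = (c, b2)" "f_op B1 i b1 = Some c"
          by (auto simp: b(1) tensor_def)
        have "acts_on_left B1 B2 i c b2"
          using True sh1[OF b(2) disjI2[OF c(2)]]
            by (simp add: acts_on_left_iff split: if_splits)
        with True c D1(7-9)[OF b(2) c(2)] show ?thesis by (simp add: b(1) tensor_def algebra_simps)
      next
        case False
        with f obtain c where c: "b' = (b1, c)" "f_op B2 i b2 = Some c"
          by (auto simp: b(1) tensor_def)
        have "\<not> acts_on_left B1 B2 i b1 c"
          using False sh2[OF b(3) disjI2[OF c(2)]]
            by (simp add: acts_on_left_iff split: if_splits)
        with False c D2(7-9)[OF b(3) c(2)] show ?thesis by (simp add: b(1) tensor_def algebra_simps)
      qed
    qed
    show "\<forall>b'\<in>vertices ?T. f_op ?T i b = Some b' \<longleftrightarrow> e_op ?T i b' = Some b"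
    proof
      fix b' assume "b' \<in> vertices ?T"
      then obtain c1 c2 where c: "b' = (c1, c2)" "c1 \<in> vertices B1" "c2 \<in> vertices B2"
        by (auto simp: tensor_def)
      show "f_op ?T i b = Some b' \<longleftrightarrow> e_op ?T i b' = Some b"
      proof
        assume f: "f_op ?T i b = Some b'"
        show "e_op ?T i b' = Some b"
        proof (cases "acts_on_left B1 B2 i b1 b2")
          case True
          with f have eq: "c2 = b2" and f1: "f_op B1 i b1 = Some c1"
            by (auto simp: b(1) c(1) tensor_def)
          have "acts_on_left B1 B2 i c1 b2"
            using True sh1[OF b(2) disjI2[OF f1]]
            by (simp add: acts_on_left_iff split: if_splits)
          then show ?thesis using D1(10)[OF b(2) c(2)] f1 by (simp add: b(1) c(1) eq tensor_def)
        next
          case False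
          with f have eq: "c1 = b1" and f2: "f_op B2 i b2 = Some c2"
            by (auto simp: b(1) c(1) tensor_def)
          have "\<not> acts_on_left B1 B2 i b1 c2"
            using False sh2[OF b(3) disjI2[OF f2]]
            by (simp add: acts_on_left_iff split: if_splits)
          then show ?thesis using D2(10)[OF b(3) c(3)] f2 by (simp add: b(1) c(1) eq tensor_def)
        qed
      next
        assume e: "e_op ?T i b' = Some b"
        show "f_op ?T i b = Some b'"
        proof (cases "acts_on_left B1 B2 i c1 c2")
          case True
          with e have eq: "b2 = c2" and e1: "e_op B1 i c1 = Some b1"
            by (auto simp: b(1) c(1) tensor_def)
          have "acts_on_left B1 B2 i b1 c2"
            using True sh1[OF c(2) disjI1[OF e1]]
            by (simp add: acts_on_left_iff split: if_splits)
          then show ?thesis using D1(10)[OF b(2) c(2)] e1 by (simp add: b(1) c(1) eq tensor_def)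
        next
          case False
          with e have eq: "b1 = c1" and e2: "e_op B2 i c2 = Some b2"
            by (auto simp: b(1) c(1) tensor_def)
          have "\<not> acts_on_left B1 B2 i c1 b2"
            using False sh2[OF c(3) disjI1[OF e2]]
            by (simp add: acts_on_left_iff split: if_splits)
          then show ?thesis using D2(10)[OF b(3) c(3)] e2 by (simp add: b(1) c(1) eq tensor_def)
        qed
      qed
    qed
  qed
qed

lemma gl_crystal_identify:
  assumes B: "gl_crystal B" and inj: "inj_on g A" and sub: "g ` A \<subseteq> vertices B"
    and closed: "\<And>i a v. a \<in> A \<Longrightarrow> e_op B i (g a) = Some v \<or> f_op B i (g a) = Some v \<Longrightarrow> v \<in> g ` A"
  shows "gl_crystal (identify A g B)"
  unfolding gl_crystal_def
proof (intro allI ballI)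
  fix i and a assume "a \<in> vertices (identify A g B)"
  then have a: "a \<in> A" by (simp add: identify_def)
  then have ga: "g a \<in> vertices B" using sub by blast
  have inv: "inv_into A g v \<in> A \<and> g (inv_into A g v) = v" if "v \<in> g ` A" for v
    using that by (simp add: inv_into_into f_inv_into_f)
  have e: "e_op (identify A g B) i x = Some a' \<longleftrightarrow> a' \<in> A \<and> e_op B i (g x) = Some (g a')"
    if "x \<in> A" for x a'
  proof -
    have "inv_into A g v = a' \<longleftrightarrow> a' \<in> A \<and> v = g a'" if "v \<in> g ` A" for v
      using inv[OF that] inv_into_f_f[OF inj] by auto
    moreover have "v \<in> g ` A" if "e_op B i (g x) = Some v" for v
      using closed \<open>x \<in> A\<close> that by blast
    ultimately show ?thesis by (fastforce simp: identify_def)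
  qed
  have f: "f_op (identify A g B) i x = Some a' \<longleftrightarrow> a' \<in> A \<and> f_op B i (g x) = Some (g a')"
    if "x \<in> A" for x a'
  proof -
    have "inv_into A g v = a' \<longleftrightarrow> a' \<in> A \<and> v = g a'" if "v \<in> g ` A" for v
      using inv[OF that] inv_into_f_f[OF inj] by auto
    moreover have "v \<in> g ` A" if "f_op B i (g x) = Some v" for v
      using closed \<open>x \<in> A\<close> that by blast
    ultimately show ?thesis by (fastforce simp: identify_def)
  qed
  have sel: "vertices (identify A g B) = A" "wt (identify A g B) x = wt B (g x)"
    "eps (identify A g B) i x = eps B i (g x)" "phi (identify A g B) i x = phi B i (g x)" for x
    by (simp_all add: identify_def)
  note D = gl_crystalD[OF B ga]
  let ?T = "identify A g B"
  show "(\<forall>b'. e_op ?T i a = Some b' \<longrightarrow> b' \<in> vertices ?T) \<and>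
     (\<forall>b'. f_op ?T i a = Some b' \<longrightarrow> b' \<in> vertices ?T) \<and>
     phi ?T i a + eps ?T i a = (if form (wt ?T a) (simple_root i) \<noteq> 0 then 1 else 0) \<and>
     (\<forall>b'. e_op ?T i a = Some b' \<longrightarrow>
        int (eps ?T i b') = int (eps ?T i a) - 1 \<and>
        int (phi ?T i b') = int (phi ?T i a) + 1 \<and>
        wt ?T b' = wt ?T a + simple_root i) \<and>
     (\<forall>b'. f_op ?T i a = Some b' \<longrightarrow>
        int (eps ?T i b') = int (eps ?T i a) + 1 \<and>
        int (phi ?T i b') = int (phi ?T i a) - 1 \<and>
        wt ?T b' = wt ?T a - simple_root i) \<and>
     (\<forall>b'\<in>vertices ?T. f_op ?T i a = Some b' \<longleftrightarrow> e_op ?T i b' = Some a)"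
    unfolding sel
  proof (intro conjI allI impI ballI)
    fix b' assume "b' \<in> A"
    then show "f_op ?T i a = Some b' \<longleftrightarrow> e_op ?T i b' = Some a"
      unfolding f[OF a] e[OF \<open>b' \<in> A\<close>] using a D(10)[of "g b'"] sub by blast
  qed (use D(3) in \<open>simp; fail\<close> | use e[OF a] f[OF a] D(4-9) in \<open>blast\<close>)+
qed

lemma word_crystal_props:
  "gl_crystal (word_crystal r) \<and> nonneg_weights (word_crystal r) \<and>
   vertices (word_crystal r) = {w. length w = r}"
proof (induction r)
  case 0
  show ?case
    using gl_crystal_empty_word nonneg_empty_word by (auto simp: empty_word_crystal_def)
next
  case (Suc r)
  let ?A = "{w :: pos_half list. length w = Suc r}" and ?g = "\<lambda>w :: pos_half list. (hd w, tl w)"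
  let ?B = "tensor letter_crystal (word_crystal r)"
  have B: "gl_crystal ?B" "nonneg_weights ?B"
    using Suc by (simp_all add: gl_crystal_tensor nonneg_tensor gl_crystal_letter nonneg_letter)
  have V: "vertices ?B = UNIV \<times> {w. length w = r}"
    using Suc by (simp add: tensor_def letter_crystal_def)
  have im: "?g ` ?A = vertices ?B"
  proof
    show "vertices ?B \<subseteq> ?g ` ?A"
    proof
      fix p assume "p \<in> vertices ?B"
      then obtain c v where "p = (c, v)" "length v = r" unfolding V by blast
      then show "p \<in> ?g ` ?A" by (intro image_eqI[of _ _ "c # v"]) simp_all
    qed
    show "?g ` ?A \<subseteq> vertices ?B" unfolding V by auto
  qed
  have inj: "inj_on ?g ?A"
  proof (rule inj_onI)
    fix v w assume "v \<in> ?A" "w \<in> ?A" "?g v = ?g w"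
    then show "v = w" by (cases v; cases w) auto
  qed
  have "gl_crystal (identify ?A ?g ?B)"
  proof (rule gl_crystal_identify[OF B(1) inj])
    show "?g ` ?A \<subseteq> vertices ?B" unfolding im ..
  next
    fix i a v assume a: "a \<in> ?A"
      and v: "e_op ?B i (?g a) = Some v \<or> f_op ?B i (?g a) = Some v"
    from a have ga: "?g a \<in> vertices ?B" unfolding im[symmetric] by (rule imageI)
    from v have "v \<in> vertices ?B"
      by (elim disjE) (rule gl_crystalD(1,2)[OF B(1) ga], assumption)+
    then show "v \<in> ?g ` ?A" unfolding im .
  qed
  moreover have "nonneg_weights (identify ?A ?g ?B)"
    using B(2) V by (auto simp: nonneg_weights_def identify_def)
  moreover have "vertices (identify ?A ?g ?B) = ?A"
    by (simp add: identify_def)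
  ultimately show ?case unfolding word_crystal.simps by blast
qed

lemmas gl_crystal_word = word_crystal_props[THEN conjunct1]
  and nonneg_word = word_crystal_props[THEN conjunct2, THEN conjunct1]
  and vertices_word = word_crystal_props[THEN conjunct2, THEN conjunct2]

lemma form_letter_eq_0_iff:
  "form (wt letter_crystal a) (simple_root i) = 0 \<longleftrightarrow> a \<noteq> i \<and> a \<noteq> plus_half i"
  by (auto simp: letter_crystal_def form_simple_root_eq_0_iff lookup_single when_def)

lemma wt_word_Cons:
  "wt (word_crystal (Suc r)) (a # w) = wt letter_crystal a + wt (word_crystal r) w"
  by (simp add: identify_def tensor_def)

lemma form_word_eq_0_iff:
  "form (wt (word_crystal (length w)) w) (simple_root i) = 0 \<longleftrightarrow>
    i \<notin> set w \<and> plus_half i \<notin> set w"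
proof (induction w)
  case Nil
  show ?case by (simp add: empty_word_crystal_def form_def)
next
  case (Cons a w)
  have "form (wt letter_crystal a + wt (word_crystal (length w)) w) (simple_root i) = 0 \<longleftrightarrow>
      form (wt letter_crystal a) (simple_root i) = 0 \<and>
      form (wt (word_crystal (length w)) w) (simple_root i) = 0"
    by (rule form_tensor_eq_0_iff[OF nonneg_letter nonneg_word])
      (simp_all add: vertices_word letter_crystal_def)
  then show ?case
    using Cons by (auto simp: wt_word_Cons form_letter_eq_0_iff simp del: word_crystal.simps)
qed

text \<open>
  On a word, \<open>e\<^sub>i\<close> and \<open>f\<^sub>i\<close> can only change the first (\<open>i\<close> an integer) or the last (otherwise) of the
  letters \<open>i\<close>, \<open>i + 1/2\<close>.
\<close>

definition changes_to :: "pos_half \<Rightarrow> pos_half \<Rightarrow> pos_half \<Rightarrow> pos_half list \<Rightarrow> pos_half list \<Rightarrow> bool"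
  where "changes_to i x y w w' \<longleftrightarrow> (\<exists>u v. w = u @ x # v \<and> w' = u @ y # v \<and>
    (if is_integer i then set u \<inter> {i, plus_half i} = {} else set v \<inter> {i, plus_half i} = {}))"

lemma changes_to_Cons:
  assumes "if is_integer i then a \<in> {i, plus_half i} else set w \<inter> {i, plus_half i} = {}"
    and "x \<in> {i, plus_half i}"
  shows "changes_to i x y (a # w) z \<longleftrightarrow> a = x \<and> z = y # w"
proof
  assume "changes_to i x y (a # w) z"
  then obtain u v where uv: "a # w = u @ x # v" "z = u @ y # v"
    "if is_integer i then set u \<inter> {i, plus_half i} = {} else set v \<inter> {i, plus_half i} = {}"
    unfolding changes_to_def by blast
  then show "a = x \<and> z = y # w"
    using assms by (cases u) (auto split: if_splits)
next
  assume "a = x \<and> z = y # w"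
  then have "a # w = [] @ x # w" "z = [] @ y # w" by auto
  then show "changes_to i x y (a # w) z"
    unfolding changes_to_def using assms(1) by (intro exI[of _ "[]"] exI[of _ w]) auto
qed

lemma changes_to_Cons_skip:
  assumes "if is_integer i then a \<notin> {i, plus_half i} else set w \<inter> {i, plus_half i} \<noteq> {}"
    and "x \<in> {i, plus_half i}"
  shows "changes_to i x y (a # w) z \<longleftrightarrow> (\<exists>w'. changes_to i x y w w' \<and> z = a # w')"
proof
  assume "changes_to i x y (a # w) z"
  then obtain u v where uv: "a # w = u @ x # v" "z = u @ y # v"
    "if is_integer i then set u \<inter> {i, plus_half i} = {} else set v \<inter> {i, plus_half i} = {}"
    unfolding changes_to_def by blast
  then obtain u' where u: "u = a # u'" using assms by (cases u) (auto split: if_splits)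
  with uv have "changes_to i x y w (u' @ y # v)"
    unfolding changes_to_def by (intro exI[of _ u'] exI[of _ v]) (auto split: if_splits)
  with uv u show "\<exists>w'. changes_to i x y w w' \<and> z = a # w'" by auto
next
  assume "\<exists>w'. changes_to i x y w w' \<and> z = a # w'"
  then obtain u v where uv: "w = u @ x # v" "z = a # u @ y # v"
    "if is_integer i then set u \<inter> {i, plus_half i} = {} else set v \<inter> {i, plus_half i} = {}"
    unfolding changes_to_def by blast
  then show "changes_to i x y (a # w) z"
    unfolding changes_to_def using assms(1)
    by (intro exI[of _ "a # u"] exI[of _ v]) (auto split: if_splits)
qed

lemma e_f_word_iff:
  "(e_op (word_crystal (length w)) i w = Some w' \<longleftrightarrow> changes_to i (plus_half i) i w w') \<and>
   (f_op (word_crystal (length w)) i w = Some w' \<longleftrightarrow> changes_to i i (plus_half i) w w')"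
proof (induction w arbitrary: w')
  case Nil
  show ?case by (simp add: empty_word_crystal_def changes_to_def)
next
  case (Cons a w)
  let ?W = "word_crystal (length w)"
  let ?B = "tensor letter_crystal ?W"
  let ?A = "{w' :: pos_half list. length w' = Suc (length w)}"
  have B: "gl_crystal ?B"
    by (rule gl_crystal_tensor[OF gl_crystal_letter nonneg_letter gl_crystal_word nonneg_word])
  have aw: "(a, w) \<in> vertices ?B" by (simp add: tensor_def vertices_word letter_crystal_def)
  have inv: "inv_into ?A (\<lambda>w. (hd w, tl w)) (c, v) = c # v" if "length v = length w" for c v
  proof (rule inv_into_f_eq)
    show "inj_on (\<lambda>w :: pos_half list. (hd w, tl w)) ?A"
    proof (rule inj_onI)
      fix v w' assume "v \<in> ?A" "w' \<in> ?A" "(hd v, tl v) = (hd w', tl w')"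
      then show "v = w'" by (cases v; cases w') auto
    qed
  qed (use that in auto)
  have len: "length (snd p) = length w" if "p \<in> vertices ?B" for p
    using that by (auto simp: tensor_def vertices_word)
  have inv': "map_option (inv_into ?A (\<lambda>w. (hd w, tl w))) X = map_option (\<lambda>(c, v). c # v) X"
    if "\<And>p. X = Some p \<Longrightarrow> p \<in> vertices ?B" for X
  proof (cases X)
    case (Some p)
    then show ?thesis using len[OF that[OF Some]] by (cases p) (simp add: inv)
  qed simp
  have eq: "e_op (word_crystal (length (a # w))) i (a # w) =
      map_option (\<lambda>(c, v). c # v) (e_op ?B i (a, w))"
    "f_op (word_crystal (length (a # w))) i (a # w) =
      map_option (\<lambda>(c, v). c # v) (f_op ?B i (a, w))"
    using inv'[OF gl_crystalD(1)[OF B aw]] inv'[OF gl_crystalD(2)[OF B aw]]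
    by (simp_all add: identify_def)
  have left: "acts_on_left letter_crystal ?W i a w \<longleftrightarrow>
      (if is_integer i then a \<in> {i, plus_half i} else set w \<inter> {i, plus_half i} = {})"
    by (auto simp: acts_on_left_iff form_letter_eq_0_iff
        form_word_eq_0_iff)
  show ?case
  proof (cases "acts_on_left letter_crystal ?W i a w")
    case True
    with left have l: "if is_integer i then a \<in> {i, plus_half i}
        else set w \<inter> {i, plus_half i} = {}" by simp
    have "changes_to i (plus_half i) i (a # w) w' \<longleftrightarrow> a = plus_half i \<and> w' = i # w"
      "changes_to i i (plus_half i) (a # w) w' \<longleftrightarrow> a = i \<and> w' = plus_half i # w"
      by (rule changes_to_Cons[OF l]; simp)+
    with True show ?thesis unfolding eq by (auto simp: tensor_def letter_crystal_def)
  next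
    case False
    with left have l: "if is_integer i then a \<notin> {i, plus_half i}
        else set w \<inter> {i, plus_half i} \<noteq> {}" by (simp split: if_splits)
    have "changes_to i (plus_half i) i (a # w) w' \<longleftrightarrow>
        (\<exists>v. changes_to i (plus_half i) i w v \<and> w' = a # v)"
      "changes_to i i (plus_half i) (a # w) w' \<longleftrightarrow>
        (\<exists>v. changes_to i i (plus_half i) w v \<and> w' = a # v)"
      by (rule changes_to_Cons_skip[OF l]; simp)+
    with False show ?thesis unfolding eq
      by (auto simp: tensor_def Cons.IH[THEN conjunct1, symmetric] Cons.IH[THEN conjunct2, symmetric])
  qed
qed

lemma length_reading_word: "length (reading_word T) = sum_list (map length T)"
  by (induction T) (auto simp: reading_word_def)

lemma inj_on_reading_word: "inj_on reading_word (quasi_ribbon_tableaux \<alpha>)"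
proof (rule inj_onI)
  fix S T assume "S \<in> quasi_ribbon_tableaux \<alpha>" "T \<in> quasi_ribbon_tableaux \<alpha>"
    and eq: "reading_word S = reading_word T"
  then have "map length S = map length T" by (simp add: quasi_ribbon_tableaux_def)
  with eq show "S = T"
  proof (induction S arbitrary: T)
    case (Cons r S)
    then show ?case by (cases T) (auto simp: reading_word_def)
  qed simp
qed

lemma reading_word_split:
  assumes "reading_word T = u @ x # v"
  obtains R1 p q R2 where "T = R1 @ (p @ x # q) # R2"
    "u = reading_word R1 @ rev q" "v = rev p @ reading_word R2"
  using assms
proof (induction T arbitrary: u thesis)
  case Nil
  then show ?case by (simp add: reading_word_def)
next
  case (Cons r T)
  from Cons.prems(2) have eq: "rev r @ reading_word T = u @ x # v" by (simp add: reading_word_def)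
  then consider (a) us where "rev r = u @ x # us" "us @ reading_word T = v"
    | (b) us where "u = rev r @ us" "reading_word T = us @ x # v"
    by (auto simp: append_eq_append_conv2 append_eq_Cons_conv Cons_eq_append_conv) 
  then show ?case
  proof cases
    case a
    then have "r = rev us @ x # rev u" by (metis rev_append rev_rev_ident rev.simps(2) append_assoc append_Cons append_Nil)
    with a show ?thesis
      by (intro Cons.prems(1)[of "[]" "rev us" "rev u" T]) (auto simp: reading_word_def)
  next
    case b
    obtain R1 p q R2 where "T = R1 @ (p @ x # q) # R2"
      "us = reading_word R1 @ rev q" "v = rev p @ reading_word R2"
      using Cons.IH[OF _ b(2)] by blast
    with b show ?thesis
      by (intro Cons.prems(1)[of "r # R1" p q R2]) (auto simp: reading_word_def)
  qed
qed

lemma all_Suc_append_Cons: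
  "(\<forall>k. Suc k < length (R1 @ r # R2) \<longrightarrow> P ((R1 @ r # R2) ! k) ((R1 @ r # R2) ! Suc k)) \<longleftrightarrow>
   (\<forall>k. Suc k < length R1 \<longrightarrow> P (R1 ! k) (R1 ! Suc k)) \<and>
   (\<forall>k. Suc k < length R2 \<longrightarrow> P (R2 ! k) (R2 ! Suc k)) \<and>
   (R1 \<noteq> [] \<longrightarrow> P (last R1) r) \<and> (R2 \<noteq> [] \<longrightarrow> P r (hd R2))"
proof (induction R1)
  case Nil
  show ?case by (cases R2) (auto simp: nth_Cons all_conj_distrib split: nat.splits) 
next
  case (Cons s R1)
  have Cons_all: "(\<forall>k. Suc k < length (s # L) \<longrightarrow> P ((s # L) ! k) ((s # L) ! Suc k)) \<longleftrightarrow>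
     (L \<noteq> [] \<longrightarrow> P s (hd L)) \<and> (\<forall>k. Suc k < length L \<longrightarrow> P (L ! k) (L ! Suc k))" for L
    by (cases L) (auto simp: nth_Cons split: nat.splits)
  show ?case
    unfolding append_Cons Cons_all Cons.IH by (cases R1) auto
qed

lemma quasi_ribbon_replace:
  assumes T: "R1 @ (p @ x # q) # R2 \<in> quasi_ribbon_tableaux \<alpha>"
    and left: "\<And>a. a \<in> set p \<Longrightarrow> row_rel a x \<Longrightarrow> row_rel a y"
    and right: "\<And>a. a \<in> set q \<Longrightarrow> row_rel x a \<Longrightarrow> row_rel y a"
    and above: "\<And>a. a \<in> set (reading_word R1) \<Longrightarrow> col_rel a x \<Longrightarrow> col_rel a y"
    and below: "\<And>a. a \<in> set (reading_word R2) \<Longrightarrow> col_rel x a \<Longrightarrow> col_rel y a"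
  shows "R1 @ (p @ y # q) # R2 \<in> quasi_ribbon_tableaux \<alpha>"
proof -
  from T have comp: "composition \<alpha>" and shape: "map length (R1 @ (p @ x # q) # R2) = \<alpha>"
    and rows: "\<forall>r\<in>set (R1 @ (p @ x # q) # R2). sorted_wrt row_rel r"
    and cols: "\<forall>k. Suc k < length (R1 @ (p @ x # q) # R2) \<longrightarrow>
      col_rel (last ((R1 @ (p @ x # q) # R2) ! k)) (hd ((R1 @ (p @ x # q) # R2) ! Suc k))"
    unfolding quasi_ribbon_tableaux_def mem_Collect_eq by blast+
  have ne: "r \<noteq> []" if "r \<in> set R1 \<union> set R2" for r
    using comp that unfolding shape[symmetric] composition_def by auto
  have R1: "last (last R1) \<in> set (reading_word R1)" if "R1 \<noteq> []"
    using that ne[of "last R1"] by (auto simp: reading_word_def intro!: bexI[of _ "last R1"])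
  have R2: "hd (hd R2) \<in> set (reading_word R2)" if "R2 \<noteq> []"
    using that ne[of "hd R2"] by (auto simp: reading_word_def intro!: bexI[of _ "hd R2"])
  note split = all_Suc_append_Cons[where P = "\<lambda>r s. col_rel (last r) (hd s)"]
  note cols' = cols[unfolded split]
  have "R1 \<noteq> [] \<longrightarrow> col_rel (last (last R1)) (hd (p @ y # q))"
    using cols' above[OF R1] by (cases p) simp_all
  moreover have "R2 \<noteq> [] \<longrightarrow> col_rel (last (p @ y # q)) (hd (hd R2))"
    using cols' below[OF R2] by (cases q) simp_all
  ultimately have "\<forall>k. Suc k < length (R1 @ (p @ y # q) # R2) \<longrightarrow>
      col_rel (last ((R1 @ (p @ y # q) # R2) ! k)) (hd ((R1 @ (p @ y # q) # R2) ! Suc k))"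
    unfolding split using cols' by blast
  moreover have "\<forall>r\<in>set (R1 @ (p @ y # q) # R2). sorted_wrt row_rel r"
    using rows left right by (auto simp: sorted_wrt_append)
  ultimately show ?thesis
    using comp shape by (simp add: quasi_ribbon_tableaux_def)
qed

lemma rel_neighbours:
  "row_rel a i \<longleftrightarrow> a < i \<or> (a = i \<and> is_integer i)"
  "row_rel a (plus_half i) \<longleftrightarrow> a < i \<or> a = i \<or> (a = plus_half i \<and> \<not> is_integer i)"
  "row_rel i a \<longleftrightarrow> plus_half i < a \<or> a = plus_half i \<or> (a = i \<and> is_integer i)"
  "row_rel (plus_half i) a \<longleftrightarrow> plus_half i < a \<or> (a = plus_half i \<and> \<not> is_integer i)"
  "col_rel a i \<longleftrightarrow> a < i \<or> (a = i \<and> \<not> is_integer i)"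
  "col_rel a (plus_half i) \<longleftrightarrow> a < i \<or> a = i \<or> (a = plus_half i \<and> is_integer i)"
  "col_rel i a \<longleftrightarrow> plus_half i < a \<or> a = plus_half i \<or> (a = i \<and> \<not> is_integer i)"
  "col_rel (plus_half i) a \<longleftrightarrow> plus_half i < a \<or> (a = plus_half i \<and> is_integer i)"
proof -
  have gt: "i < a \<longleftrightarrow> plus_half i < a \<or> plus_half i = a"
    using plus_half_le_iff[of i a] by (simp only: le_less)
  have lt: "a < plus_half i \<longleftrightarrow> a < i \<or> a = i"
    using less_plus_half_iff[of a i] by (simp only: le_less)
  show
    "row_rel a i \<longleftrightarrow> a < i \<or> (a = i \<and> is_integer i)"
    "row_rel a (plus_half i) \<longleftrightarrow> a < i \<or> a = i \<or> (a = plus_half i \<and> \<not> is_integer i)"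
    "row_rel i a \<longleftrightarrow> plus_half i < a \<or> a = plus_half i \<or> (a = i \<and> is_integer i)"
    "row_rel (plus_half i) a \<longleftrightarrow> plus_half i < a \<or> (a = plus_half i \<and> \<not> is_integer i)"
    "col_rel a i \<longleftrightarrow> a < i \<or> (a = i \<and> \<not> is_integer i)"
    "col_rel a (plus_half i) \<longleftrightarrow> a < i \<or> a = i \<or> (a = plus_half i \<and> is_integer i)"
    "col_rel i a \<longleftrightarrow> plus_half i < a \<or> a = plus_half i \<or> (a = i \<and> \<not> is_integer i)"
    "col_rel (plus_half i) a \<longleftrightarrow> plus_half i < a \<or> (a = plus_half i \<and> is_integer i)"
    unfolding row_rel_def col_rel_def by (metis lt gt is_integer_plus_half)+
qed

lemma rel_shift:
  assumes xy: "(x, y) = (plus_half i, i) \<or> (x, y) = (i, plus_half i)"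
  shows "row_rel a x \<Longrightarrow> (\<not> is_integer i \<Longrightarrow> a \<notin> {i, plus_half i}) \<Longrightarrow> row_rel a y"
    and "row_rel x a \<Longrightarrow> (is_integer i \<Longrightarrow> a \<notin> {i, plus_half i}) \<Longrightarrow> row_rel y a"
    and "col_rel a x \<Longrightarrow> (is_integer i \<Longrightarrow> a \<notin> {i, plus_half i}) \<Longrightarrow> col_rel a y"
    and "col_rel x a \<Longrightarrow> (\<not> is_integer i \<Longrightarrow> a \<notin> {i, plus_half i}) \<Longrightarrow> col_rel y a"
proof -
  have *: "(row_rel a x \<longrightarrow> (\<not> is_integer i \<longrightarrow> a \<noteq> i \<and> a \<noteq> plus_half i) \<longrightarrow> row_rel a y) \<and>
    (row_rel x a \<longrightarrow> (is_integer i \<longrightarrow> a \<noteq> i \<and> a \<noteq> plus_half i) \<longrightarrow> row_rel y a) \<and>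
    (col_rel a x \<longrightarrow> (is_integer i \<longrightarrow> a \<noteq> i \<and> a \<noteq> plus_half i) \<longrightarrow> col_rel a y) \<and>
    (col_rel x a \<longrightarrow> (\<not> is_integer i \<longrightarrow> a \<noteq> i \<and> a \<noteq> plus_half i) \<longrightarrow> col_rel y a)"
    (is ?P)
    using xy
  proof
    assume "(x, y) = (plus_half i, i)"
    then have eq: "x = plus_half i" "y = i" by simp_all
    show ?P unfolding eq rel_neighbours[where a = a and i = i] by blast
  next
    assume "(x, y) = (i, plus_half i)"
    then have eq: "x = i" "y = plus_half i" by simp_all
    show ?P unfolding eq rel_neighbours[where a = a and i = i] by blast
  qed
  show "row_rel a x \<Longrightarrow> (\<not> is_integer i \<Longrightarrow> a \<notin> {i, plus_half i}) \<Longrightarrow> row_rel a y"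
    and "row_rel x a \<Longrightarrow> (is_integer i \<Longrightarrow> a \<notin> {i, plus_half i}) \<Longrightarrow> row_rel y a"
    and "col_rel a x \<Longrightarrow> (is_integer i \<Longrightarrow> a \<notin> {i, plus_half i}) \<Longrightarrow> col_rel a y"
    and "col_rel x a \<Longrightarrow> (\<not> is_integer i \<Longrightarrow> a \<notin> {i, plus_half i}) \<Longrightarrow> col_rel y a"
    using * by simp_all
qed

lemma reading_word_closed:
  assumes T: "T \<in> quasi_ribbon_tableaux \<alpha>" and ch: "changes_to i x y (reading_word T) w"
    and xy: "(x, y) = (plus_half i, i) \<or> (x, y) = (i, plus_half i)"
  shows "w \<in> reading_word ` quasi_ribbon_tableaux \<alpha>"
proof -
  from ch obtain u v where uv: "reading_word T = u @ x # v" "w = u @ y # v"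
    "if is_integer i then set u \<inter> {i, plus_half i} = {} else set v \<inter> {i, plus_half i} = {}"
    unfolding changes_to_def by blast
  from uv(1) obtain R1 p q R2 where R: "T = R1 @ (p @ x # q) # R2"
    "u = reading_word R1 @ rev q" "v = rev p @ reading_word R2"
    by (rule reading_word_split)
  have u: "a \<notin> {i, plus_half i}" if "is_integer i" "a \<in> set q \<union> set (reading_word R1)" for a
    using uv(3) that by (auto simp: R(2))
  have v: "a \<notin> {i, plus_half i}" if "\<not> is_integer i" "a \<in> set p \<union> set (reading_word R2)" for a
    using uv(3) that by (auto simp: R(3))
  have "R1 @ (p @ y # q) # R2 \<in> quasi_ribbon_tableaux \<alpha>"
  proof (rule quasi_ribbon_replace[OF T[unfolded R(1)]])
    show "row_rel a y" if "a \<in> set p" "row_rel a x" for a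
      using rel_shift(1)[OF xy that(2)] v that(1) by blast
    show "row_rel y a" if "a \<in> set q" "row_rel x a" for a
      using rel_shift(2)[OF xy that(2)] u that(1) by blast
    show "col_rel a y" if "a \<in> set (reading_word R1)" "col_rel a x" for a
      using rel_shift(3)[OF xy that(2)] u that(1) by blast
    show "col_rel y a" if "a \<in> set (reading_word R2)" "col_rel x a" for a
      using rel_shift(4)[OF xy that(2)] v that(1) by blast
  qed
  moreover have "reading_word (R1 @ (p @ y # q) # R2) = w"
    using uv(2) R by (simp add: reading_word_def)
  ultimately show ?thesis by blast
qed

theorem gl_crystal_tableau: "gl_crystal (tableau_crystal \<alpha>)"
  unfolding tableau_crystal_def
proof (rule gl_crystal_identify[OF gl_crystal_word inj_on_reading_word])
  have len: "length (reading_word T) = sum_list \<alpha>" if "T \<in> quasi_ribbon_tableaux \<alpha>" for T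
    using that by (simp add: length_reading_word quasi_ribbon_tableaux_def)
  then show "reading_word ` quasi_ribbon_tableaux \<alpha> \<subseteq> vertices (word_crystal (sum_list \<alpha>))"
    by (auto simp: vertices_word)
  fix i T v assume T: "T \<in> quasi_ribbon_tableaux \<alpha>"
    and v: "e_op (word_crystal (sum_list \<alpha>)) i (reading_word T) = Some v \<or>
      f_op (word_crystal (sum_list \<alpha>)) i (reading_word T) = Some v"
  then show "v \<in> reading_word ` quasi_ribbon_tableaux \<alpha>"
    using e_f_word_iff[of "reading_word T" i v] reading_word_closed[OF T]
    unfolding len[OF T] by blast
qed

theorem gl_crystal_tableau_tensor_letter:
  "gl_crystal (tensor (tableau_crystal \<alpha>) letter_crystal)"
proof (rule gl_crystal_tensor[OF gl_crystal_tableau _ gl_crystal_letter nonneg_letter])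
  have "reading_word T \<in> vertices (word_crystal (sum_list \<alpha>))"
    if "T \<in> quasi_ribbon_tableaux \<alpha>" for T
    using that by (simp add: vertices_word length_reading_word quasi_ribbon_tableaux_def)
  then show "nonneg_weights (tableau_crystal \<alpha>)"
    using nonneg_word by (simp add: nonneg_weights_def tableau_crystal_def identify_def)
qed

end

theory Submission
  imports Defs
begin

text \<open>
  Fix the number \<open>p\<close> of nodes preceding the inserted letter and let \<open>\<Phi>\<close> glue an arbitrary letter into an
  arbitrary tableau of shape \<open>\<alpha>\<close> after its \<open>p\<close>-th node. On the pairs for which the result is a
  quasi-ribbon tableau, \<open>\<Phi>\<close> is injective and preserves weights. Although \<open>T \<otimes> b\<close> and \<open>b \<rightarrow> T\<close> are
  read in different orders, the first (\<open>i\<close> an integer) or last (otherwise) node carrying \<open>i\<close> or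
  \<open>i + 1/2\<close> is the same in both, so \<open>\<Phi>\<close> maps arrows to arrows. As the crystals of quasi-ribbon
  tableaux are stable under the operators, the domain of \<open>\<Phi>\<close> is stable too; hence the insertion
  point does not change along a component, and \<open>\<Phi>\<close> identifies the two components.
\<close>

section \<open>Seminormal crystals\<close>

text \<open>The crystal axioms do not force an operator to be defined when the corresponding
  \<open>eps\<close> or \<open>phi\<close> is 1. With this condition, a vanishing \<open>eps\<close>
  or \<open>phi\<close> and an undefined operator become interchangeable.\<close>

definition seminormal :: "'b crystal \<Rightarrow> bool"
  where "seminormal B \<longleftrightarrow> (\<forall>i. \<forall>b\<in>vertices B.
     eps B i b = (if e_op B i b = None then 0 else 1) \<and>
     phi B i b = (if f_op B i b = None then 0 else 1))"

lemma seminormal_letter: "seminormal letter_crystal"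
  by (simp add: seminormal_def letter_crystal_def)

lemma seminormal_tensor: "seminormal B1 \<Longrightarrow> seminormal B2 \<Longrightarrow> seminormal (tensor B1 B2)"
  by (auto simp: seminormal_def tensor_def)

lemma seminormal_identify: "seminormal B \<Longrightarrow> g ` A \<subseteq> vertices B \<Longrightarrow> seminormal (identify A g B)"
  by (auto simp: seminormal_def identify_def)

lemma seminormal_word: "seminormal (word_crystal r)"
proof (induction r)
  case 0
  show ?case by (simp add: seminormal_def empty_word_crystal_def)
next
  case (Suc r)
  show ?case
    unfolding word_crystal.simps
    by (rule seminormal_identify[OF seminormal_tensor[OF seminormal_letter Suc]])
      (auto simp: tensor_def letter_crystal_def vertices_word)
qed

lemma vertices_tableau_crystal: "vertices (tableau_crystal \<alpha>) = quasi_ribbon_tableaux \<alpha>"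
  by (simp add: tableau_crystal_def identify_def)

lemma length_reading_word_tableau:
  "T \<in> quasi_ribbon_tableaux \<alpha> \<Longrightarrow> length (reading_word T) = sum_list \<alpha>"
  by (simp add: length_reading_word quasi_ribbon_tableaux_def)

lemma seminormal_tableau: "seminormal (tableau_crystal \<alpha>)"
  unfolding tableau_crystal_def
  by (rule seminormal_identify[OF seminormal_word])
    (auto simp: vertices_word length_reading_word_tableau)

text \<open>Reduces an equivalence to a one-way check: only defined operators on \<open>A\<close>
  have to be followed through \<open>\<Phi>\<close>. Stability of \<open>A\<close> confines the
  component to \<open>A\<close>, and the weights exclude extra arrows on the other side.\<close>

lemma gl_equiv_embedding:
  assumes crystal: "gl_crystal B1" "gl_crystal B2" and semi: "seminormal B1" "seminormal B2"
    and A: "A \<subseteq> vertices B2" and im: "\<And>a. a \<in> A \<Longrightarrow> \<Phi> a \<in> vertices B1" and inj: "inj_on \<Phi> A"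
    and wt: "\<And>a. a \<in> A \<Longrightarrow> wt B1 (\<Phi> a) = wt B2 a"
    and e: "\<And>i a a'. a \<in> A \<Longrightarrow> e_op B2 i a = Some a' \<Longrightarrow> a' \<in> A \<and> e_op B1 i (\<Phi> a) = Some (\<Phi> a')"
    and f: "\<And>i a a'. a \<in> A \<Longrightarrow> f_op B2 i a = Some a' \<Longrightarrow> a' \<in> A \<and> f_op B1 i (\<Phi> a) = Some (\<Phi> a')"
    and a0: "a0 \<in> A"
  shows "gl_equiv B1 (\<Phi> a0) B2 a0"
proof -
  \<comment> \<open>By weight, the two totals \<open>\<epsilon>\<^sub>i + \<phi>\<^sub>i\<close> agree, so neither summand can grow under \<open>\<Phi>\<close>.\<close>
  have ep: "eps B1 i (\<Phi> a) = eps B2 i a \<and> phi B1 i (\<Phi> a) = phi B2 i a" if a: "a \<in> A" for i a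
  proof -
    have v: "a \<in> vertices B2" "\<Phi> a \<in> vertices B1" using a A im by auto
    have "eps B2 i a \<le> eps B1 i (\<Phi> a)"
      using semi v e[OF a, of i] by (cases "e_op B2 i a") (auto simp: seminormal_def)
    moreover have "phi B2 i a \<le> phi B1 i (\<Phi> a)"
      using semi v f[OF a, of i] by (cases "f_op B2 i a") (auto simp: seminormal_def)
    moreover have "phi B1 i (\<Phi> a) + eps B1 i (\<Phi> a) = phi B2 i a + eps B2 i a"
      using gl_crystalD(3)[OF crystal(1) v(2), of i] gl_crystalD(3)[OF crystal(2) v(1), of i] wt[OF a]
      by simp
    ultimately show ?thesis by linarith
  qed
  have f': "f_op B1 i (\<Phi> a) = map_option \<Phi> (f_op B2 i a)" if a: "a \<in> A" for i a
  proof (cases "f_op B2 i a")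
    case None
    then have "phi B1 i (\<Phi> a) = 0"
      using ep[OF a] semi(2) a A by (auto simp: seminormal_def)
    then show ?thesis using semi(1) im[OF a] None by (auto simp: seminormal_def split: if_splits)
  qed (use f[OF a] in auto)
  have e': "e_op B1 i (\<Phi> a) = map_option \<Phi> (e_op B2 i a)" if a: "a \<in> A" for i a
  proof (cases "e_op B2 i a")
    case None
    then have "eps B1 i (\<Phi> a) = 0"
      using ep[OF a] semi(2) a A by (auto simp: seminormal_def)
    then show ?thesis using semi(1) im[OF a] None by (auto simp: seminormal_def split: if_splits)
  qed (use e[OF a] in auto)
  let ?R1 = "arrows B1 \<union> (arrows B1)\<inverse>" and ?R2 = "arrows B2 \<union> (arrows B2)\<inverse>"
  \<comment> \<open>The axiom relating \<open>f_op\<close> and \<open>e_op\<close> turns reversed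
    arrows into applications of \<open>e_op\<close>, so every step of an undirected path starts with
    an operator at its current vertex.\<close>
  have step_iff: "(c, c') \<in> arrows B \<union> (arrows B)\<inverse> \<longleftrightarrow> c \<in> vertices B \<and>
      (\<exists>i. f_op B i c = Some c' \<or> e_op B i c = Some c')" if "gl_crystal B" for B :: "'d crystal" and c c'
    using gl_crystalD(1,2,10)[OF that] unfolding arrows_def by blast
  have fwd: "a' \<in> A \<and> (\<Phi> a, \<Phi> a') \<in> ?R1" if "a \<in> A" "(a, a') \<in> ?R2" for a a'
    using that(2) im[OF that(1)] e[OF that(1)] f[OF that(1)]
    unfolding step_iff[OF crystal(1)] step_iff[OF crystal(2)] by blast
  \<comment> \<open>Edges at \<open>\<Phi> a\<close> lift to edges at \<open>a\<close>; iterating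
    this lifts whole paths and gives surjectivity onto the component.\<close>
  have bwd: "\<exists>a'. c = \<Phi> a' \<and> a' \<in> A \<and> (a, a') \<in> ?R2" if "a \<in> A" "(\<Phi> a, c) \<in> ?R1" for a c
    using that e f A unfolding step_iff[OF crystal(1)] step_iff[OF crystal(2)] f'[OF that(1)] e'[OF that(1)]
    by blast
  have comp2: "a \<in> A \<and> \<Phi> a \<in> component B1 (\<Phi> a0)" if "a \<in> component B2 a0" for a
    using that unfolding component_def mem_Collect_eq
  proof (induction rule: rtrancl_induct)
    case (step a a')
    then show ?case using fwd[of a a'] by (blast intro: rtrancl_into_rtrancl)
  qed (simp add: a0)
  have comp1: "c \<in> \<Phi> ` component B2 a0" if "c \<in> component B1 (\<Phi> a0)" for c
    using that unfolding component_def mem_Collect_eq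
  proof (induction rule: rtrancl_induct)
    case (step c c')
    then obtain a where a: "c = \<Phi> a" "(a0, a) \<in> ?R2\<^sup>*" by blast
    then have "a \<in> A" using comp2 by (simp add: component_def)
    from bwd[OF this step(2)[unfolded a(1)]] a(2) show ?case
      by (blast intro: rtrancl_into_rtrancl)
  qed simp
  have comp: "component B1 (\<Phi> a0) = \<Phi> ` component B2 a0" and sub: "component B2 a0 \<subseteq> A"
    using comp1 comp2 by blast+
  \<comment> \<open>The isomorphism required by \<open>gl_equiv\<close> runs from \<open>B1\<close>
    to \<open>B2\<close>, against the direction of \<open>\<Phi>\<close>.\<close>
  define \<psi> where "\<psi> = inv_into A \<Phi>"
  have \<psi>: "\<psi> (\<Phi> a) = a" if "a \<in> A" for a
    using that inj by (simp add: \<psi>_def)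
  have "component_iso B1 (\<Phi> a0) B2 a0 \<psi>"
    unfolding component_iso_def comp
  proof (intro conjI ballI allI)
    show "bij_betw \<psi> (\<Phi> ` component B2 a0) (component B2 a0)"
      by (rule bij_betw_byWitness[where f' = \<Phi>]) (use \<psi> sub in auto)
  next
    fix i c c' assume "c \<in> \<Phi> ` component B2 a0" "c' \<in> \<Phi> ` component B2 a0"
    then obtain a a' where a: "c = \<Phi> a" "c' = \<Phi> a'" "a \<in> A" "a' \<in> A" using sub by blast
    show "f_op B1 i c = Some c' \<longleftrightarrow> f_op B2 i (\<psi> c) = Some (\<psi> c')"
      using a f[OF a(3), of i] inj_onD[OF inj, of _ a'] by (auto simp: \<psi> f')
  qed (use \<psi> wt ep sub in auto)
  then show ?thesis
    unfolding gl_equiv_def using crystal A a0 im \<psi> by blast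
qed


section \<open>The operators on words\<close>

text \<open>This is the tensor product rule for concatenated words. For integer \<open>i\<close> the
  first relevant letter changes, so a change in \<open>v\<close> needs \<open>w\<close> free of
  them; otherwise the last one changes and the roles are exchanged. Equal lengths cut both words at
  the same place.\<close>

lemma changes_to_append:
  assumes "length w = length w'"
  shows "changes_to i x y (w @ v) (w' @ v') \<longleftrightarrow>
    changes_to i x y w w' \<and> v = v' \<and> (\<not> is_integer i \<longrightarrow> set v \<inter> {i, plus_half i} = {}) \<or>
    w = w' \<and> changes_to i x y v v' \<and> (is_integer i \<longrightarrow> set w \<inter> {i, plus_half i} = {})"
    (is "?l \<longleftrightarrow> ?r1 \<or> ?r2")
proof
  assume ?l
  then obtain s t where st: "w @ v = s @ x # t" "w' @ v' = s @ y # t"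
    "if is_integer i then set s \<inter> {i, plus_half i} = {} else set t \<inter> {i, plus_half i} = {}"
    unfolding changes_to_def by blast
  from st(1) consider (l) t' where "w = s @ x # t'" "t = t' @ v"
    | (r) s' where "s = w @ s'" "v = s' @ x # t"
    by (auto simp: append_eq_append_conv2 append_eq_Cons_conv Cons_eq_append_conv)
  then show "?r1 \<or> ?r2"
  proof cases
    case l
    with st(2) have "w' @ v' = (s @ y # t') @ v" by simp
    moreover have "length w' = length (s @ y # t')" using l assms by simp
    ultimately have "w' = s @ y # t'" "v' = v"
      using append_eq_append_conv[OF disjI1] by blast+
    with l st(3) have ?r1 unfolding changes_to_def by (auto split: if_splits)
    then show ?thesis ..
  next
    case r
    with st(2) assms have "w' = w" "v' = s' @ y # t" by (simp_all add: append_eq_append_conv)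
    with r st(3) have ?r2 unfolding changes_to_def by (auto split: if_splits)
    then show ?thesis ..
  qed
next
  assume "?r1 \<or> ?r2"
  then show ?l
  proof
    assume r: ?r1
    then obtain s t where "w = s @ x # t" "w' = s @ y # t"
      "if is_integer i then set s \<inter> {i, plus_half i} = {} else set t \<inter> {i, plus_half i} = {}"
      unfolding changes_to_def by blast
    with r show ?l unfolding changes_to_def
      by (intro exI[of _ s] exI[of _ "t @ v"]) (auto split: if_splits)
  next
    assume r: ?r2
    then obtain s t where "v = s @ x # t" "v' = s @ y # t"
      "if is_integer i then set s \<inter> {i, plus_half i} = {} else set t \<inter> {i, plus_half i} = {}"
      unfolding changes_to_def by blast
    with r show ?l unfolding changes_to_def
      by (intro exI[of _ "w @ s"] exI[of _ t]) (auto split: if_splits)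
  qed
qed

lemma changes_to_singleton: "changes_to i x y [b] [b'] \<longleftrightarrow> b = x \<and> b' = y"
  unfolding changes_to_def by (auto simp: Cons_eq_append_conv append_eq_Cons_conv)

lemma changes_to_mem: "changes_to i x y w w' \<Longrightarrow> x \<in> set w"
  unfolding changes_to_def by auto

section \<open>Operators on tableaux and on tableaux tensored with a letter\<close>

text \<open>The reading words of one shape are stable under the operators, so the
  \<open>inv_into\<close> hidden in \<open>identify\<close> is only ever evaluated inside the image
  of \<open>reading_word\<close>.\<close>

lemma e_f_tableau_iff:
  assumes T: "T \<in> quasi_ribbon_tableaux \<alpha>"
  shows "e_op (tableau_crystal \<alpha>) i T = Some T' \<longleftrightarrow> T' \<in> quasi_ribbon_tableaux \<alpha> \<and>
      changes_to i (plus_half i) i (reading_word T) (reading_word T')"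
    and "f_op (tableau_crystal \<alpha>) i T = Some T' \<longleftrightarrow> T' \<in> quasi_ribbon_tableaux \<alpha> \<and>
      changes_to i i (plus_half i) (reading_word T) (reading_word T')"
proof -
  let ?A = "quasi_ribbon_tableaux \<alpha>"
  have inv: "map_option (inv_into ?A reading_word) X = Some T' \<longleftrightarrow>
      T' \<in> ?A \<and> X = Some (reading_word T')"
    if "\<And>v. X = Some v \<Longrightarrow> v \<in> reading_word ` ?A" for X
  proof (cases X)
    case (Some v)
    then have v: "v \<in> reading_word ` ?A" by (rule that)
    show ?thesis
      using inv_into_into[OF v] f_inv_into_f[OF v] inv_into_f_f[OF inj_on_reading_word] Some by auto
  qed simp
  note w = e_f_word_iff[of "reading_word T", unfolded length_reading_word_tableau[OF T]]
  note closed = reading_word_closed[OF T]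
  let ?W = "word_crystal (sum_list \<alpha>)"
  have "e_op (tableau_crystal \<alpha>) i T = Some T' \<longleftrightarrow>
      T' \<in> ?A \<and> e_op ?W i (reading_word T) = Some (reading_word T')"
    unfolding tableau_crystal_def identify_def crystal.simps
    by (rule inv) (use closed[of i "plus_half i" i] w in blast)
  then show "e_op (tableau_crystal \<alpha>) i T = Some T' \<longleftrightarrow> T' \<in> ?A \<and>
      changes_to i (plus_half i) i (reading_word T) (reading_word T')"
    using w by blast
  have "f_op (tableau_crystal \<alpha>) i T = Some T' \<longleftrightarrow>
      T' \<in> ?A \<and> f_op ?W i (reading_word T) = Some (reading_word T')"
    unfolding tableau_crystal_def identify_def crystal.simps
    by (rule inv) (use closed[of i i "plus_half i"] w in blast)
  then show "f_op (tableau_crystal \<alpha>) i T = Some T' \<longleftrightarrow> T' \<in> ?A \<and>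
      changes_to i i (plus_half i) (reading_word T) (reading_word T')"
    using w by blast
qed

text \<open>Lets \<open>T \<otimes> b\<close> be handled as the word \<open>w(T) b\<close>. Word
  crystals are bracketed to the right while \<open>b\<close> is attached on the right;
  \<open>changes_to_append\<close> bridges the two bracketings.\<close>

lemma e_f_tableau_tensor_letter:
  assumes T: "T \<in> quasi_ribbon_tableaux \<alpha>"
  shows "e_op (tensor (tableau_crystal \<alpha>) letter_crystal) i (T, b) = Some (T', b') \<Longrightarrow>
      T' \<in> quasi_ribbon_tableaux \<alpha> \<and>
      changes_to i (plus_half i) i (reading_word T @ [b]) (reading_word T' @ [b'])"
    and "f_op (tensor (tableau_crystal \<alpha>) letter_crystal) i (T, b) = Some (T', b') \<Longrightarrow>
      T' \<in> quasi_ribbon_tableaux \<alpha> \<and>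
      changes_to i i (plus_half i) (reading_word T @ [b]) (reading_word T' @ [b'])"
proof -
  have "form (wt (tableau_crystal \<alpha>) T) (simple_root i) = 0 \<longleftrightarrow>
      i \<notin> set (reading_word T) \<and> plus_half i \<notin> set (reading_word T)"
    using form_word_eq_0_iff[of "reading_word T" i]
    by (simp add: length_reading_word_tableau[OF T] tableau_crystal_def identify_def)
  then have left: "acts_on_left (tableau_crystal \<alpha>) letter_crystal i T b \<longleftrightarrow>
    (if is_integer i then set (reading_word T) \<inter> {i, plus_half i} \<noteq> {} else b \<notin> {i, plus_half i})"
    by (auto simp: acts_on_left_iff form_letter_eq_0_iff)
  have app: "changes_to i x y (reading_word T @ [b]) (reading_word S @ [c]) \<longleftrightarrow>
    changes_to i x y (reading_word T) (reading_word S) \<and> b = c \<and> (\<not> is_integer i \<longrightarrow> b \<notin> {i, plus_half i}) \<or>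
    reading_word T = reading_word S \<and> b = x \<and> c = y \<and>
      (is_integer i \<longrightarrow> set (reading_word T) \<inter> {i, plus_half i} = {})"
    if "S \<in> quasi_ribbon_tableaux \<alpha>" for S c x y
    using changes_to_append[of "reading_word T" "reading_word S" i x y "[b]" "[c]"]
    by (auto simp: length_reading_word_tableau[OF T] length_reading_word_tableau[OF that] changes_to_singleton)
  show "T' \<in> quasi_ribbon_tableaux \<alpha> \<and>
      changes_to i (plus_half i) i (reading_word T @ [b]) (reading_word T' @ [b'])"
    if "e_op (tensor (tableau_crystal \<alpha>) letter_crystal) i (T, b) = Some (T', b')"
  proof (cases "acts_on_left (tableau_crystal \<alpha>) letter_crystal i T b")
    case True
    then have *: "e_op (tableau_crystal \<alpha>) i T = Some T'" "b' = b"
      using that by (auto simp: tensor_def)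
    with e_f_tableau_iff(1)[OF T] app left True show ?thesis by (simp split: if_splits)
  next
    case False
    then have "T' = T" "b = plus_half i" "b' = i"
      using that by (auto simp: tensor_def letter_crystal_def split: if_splits)
    with app[OF T] left False T show ?thesis by (simp split: if_splits)
  qed
  show "T' \<in> quasi_ribbon_tableaux \<alpha> \<and>
      changes_to i i (plus_half i) (reading_word T @ [b]) (reading_word T' @ [b'])"
    if "f_op (tensor (tableau_crystal \<alpha>) letter_crystal) i (T, b) = Some (T', b')"
  proof (cases "acts_on_left (tableau_crystal \<alpha>) letter_crystal i T b")
    case True
    then have *: "f_op (tableau_crystal \<alpha>) i T = Some T'" "b' = b"
      using that by (auto simp: tensor_def)
    with e_f_tableau_iff(2)[OF T] app left True show ?thesis by (simp split: if_splits)
  next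
    case False
    then have "T' = T" "b = i" "b' = plus_half i"
      using that by (auto simp: tensor_def letter_crystal_def split: if_splits)
    with app[OF T] left False T show ?thesis by (simp split: if_splits)
  qed
qed

section \<open>Weights as letter counts\<close>

lemma wt_word: "wt (word_crystal (length w)) w = sum_list (map epsilon w)"
proof (induction w)
  case Nil
  show ?case by (simp add: empty_word_crystal_def)
next
  case (Cons a w)
  then show ?case
    using wt_word_Cons[of "length w" a w] by (simp add: letter_crystal_def del: word_crystal.simps)
qed

lemma wt_tableau:
  "T \<in> quasi_ribbon_tableaux \<alpha> \<Longrightarrow> wt (tableau_crystal \<alpha>) T = sum_list (map epsilon (reading_word T))"
  using wt_word[of "reading_word T"]
  by (simp add: length_reading_word_tableau tableau_crystal_def identify_def)


section \<open>Insertion at a given node\<close>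

text \<open>Parity permits a repeated letter along rows or along columns but never both, so one step
  of each kind is strict.\<close>

lemma row_col_less: "row_rel a b \<Longrightarrow> col_rel b c \<Longrightarrow> a < c"
  and col_row_less: "col_rel a b \<Longrightarrow> row_rel b c \<Longrightarrow> a < c"
  by (auto simp: row_rel_def col_rel_def)

lemma row_rel_trans: "row_rel a b \<Longrightarrow> row_rel b c \<Longrightarrow> row_rel a c"
  by (auto simp: row_rel_def)

lemma col_rel_trans: "col_rel a b \<Longrightarrow> col_rel b c \<Longrightarrow> col_rel a c"
  by (auto simp: col_rel_def)

text \<open>The order is total, so the letter can stand either to the left of a given entry or below
  it, and never both. This dichotomy is what makes the gluing legal.\<close>

lemma bumps_iff: "bumps b t \<longleftrightarrow> row_rel b t"
  and not_bumps_iff: "\<not> bumps b t \<longleftrightarrow> col_rel t b"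
  by (auto simp: bumps_def row_rel_def col_rel_def)

text \<open>Comparing all letters instead of the two touching ones makes the column condition a
  \<open>sorted_wrt\<close> property, which is inherited by pieces of a cut list of rows.\<close>

definition rows_below :: "pos_half list \<Rightarrow> pos_half list \<Rightarrow> bool"
  where "rows_below r s \<longleftrightarrow> (\<forall>a\<in>set r. \<forall>c\<in>set s. col_rel a c)"

lemma rows_below_iff:
  assumes "r \<noteq> []" "s \<noteq> []" "sorted_wrt row_rel r" "sorted_wrt row_rel s"
  shows "rows_below r s \<longleftrightarrow> col_rel (last r) (hd s)"
proof
  assume *: "col_rel (last r) (hd s)"
  have "a = last r \<or> row_rel a (last r)" if "a \<in> set r" for a
    using that assms(3) by (cases r rule: rev_cases) (auto simp: sorted_wrt_append)
  moreover have "c = hd s \<or> row_rel (hd s) c" if "c \<in> set s" for c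
    using that assms(4) by (cases s) auto
  moreover have "col_rel a c"
    if "a = last r \<or> row_rel a (last r)" "c = hd s \<or> row_rel (hd s) c" for a c
    using that * by (auto simp: row_rel_def col_rel_def)
  ultimately show "rows_below r s"
    unfolding rows_below_def by blast
qed (use assms in \<open>simp add: rows_below_def\<close>)

lemma quasi_ribbon_tableaux_iff:
  "T \<in> quasi_ribbon_tableaux \<alpha> \<longleftrightarrow> composition \<alpha> \<and> map length T = \<alpha> \<and>
    (\<forall>r\<in>set T. sorted_wrt row_rel r) \<and> sorted_wrt rows_below T"
proof -
  have "(\<forall>k. Suc k < length T \<longrightarrow> col_rel (last (T ! k)) (hd (T ! Suc k))) \<longleftrightarrow> sorted_wrt rows_below T"
    if "\<forall>r\<in>set T. r \<noteq> [] \<and> sorted_wrt row_rel r"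
    using that
  proof (induction T)
    case (Cons r T)
    \<comment> \<open>Transitivity passes through an entry of the intermediate row, so that row has
      to be nonempty; for tableaux this comes from \<open>composition\<close>.\<close>
    have "rows_below r s" if "rows_below r (hd T)" "sorted_wrt rows_below T" "s \<in> set T" for s
    proof (cases T)
      case (Cons t T')
      then have "t \<noteq> []" using Cons.prems by auto
      moreover have "s = t \<or> rows_below t s" using that Cons by auto
      ultimately show ?thesis using that(1) Cons unfolding rows_below_def
        by (metis col_rel_trans list.sel(1) hd_in_set)
    qed (use that in simp)
    moreover have "col_rel (last r) (hd (hd T)) \<longleftrightarrow> rows_below r (hd T)" if "T \<noteq> []"
      using rows_below_iff[of r "hd T"] that Cons.prems by auto
    moreover have "hd T \<in> set T" if "T \<noteq> []" using that by simp
    ultimately show ?case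
      using Cons.IH Cons.prems all_Suc_append_Cons[of "[]" r T "\<lambda>r s. col_rel (last r) (hd s)"]
      by (cases "T = []") auto
  qed simp
  moreover have "\<forall>r\<in>set T. r \<noteq> []" if "composition \<alpha>" "map length T = \<alpha>"
    using that by (auto simp: composition_def)
  ultimately show ?thesis unfolding quasi_ribbon_tableaux_def by blast
qed

lemma composition_map_length_iff: "composition (map length T) \<longleftrightarrow> [] \<notin> set T"
  by (auto simp: composition_def)

section \<open>Gluing in a letter after a fixed number of nodes\<close>

definition insert_at :: "nat \<Rightarrow> pos_half \<Rightarrow> tableau \<Rightarrow> tableau"
  where "insert_at p b T = glue (take_nodes p T) b (drop_nodes p T)"

lemma insert_letter_eq: "insert_letter b T = insert_at (insertion_point b T) b T"
  by (simp add: insert_letter_def insert_at_def Let_def)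

lemma insert_at_end:
  assumes "[] \<notin> set T"
  shows "insert_at (sum_list (map length T)) b T = T @ [[b]]"
proof -
  have "drop_nodes (sum_list (map length T)) T = []" by (induction T) auto
  moreover have "take_nodes (sum_list (map length T)) T = T"
    using assms
  proof (induction T)
    case (Cons r T)
    \<comment> \<open>\<open>take_nodes\<close> stops once no nodes are left to take, so trailing
      empty rows would be lost without the assumption.\<close>
    then show ?case by (cases T) auto
  qed simp
  ultimately show ?thesis by (simp add: insert_at_def glue_def)
qed

text \<open>A cut between two rows is treated as a cut before the first node of the lower one:
  \<open>q\<close> is nonempty, while an empty \<open>p\<close> contributes no row of its
  own.\<close>

lemma insert_at_middle:
  assumes "[] \<notin> set R" "q \<noteq> []"
  shows "insert_at (sum_list (map length R) + length p) b (R @ (p @ q) # Q) =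
    R @ (if p = [] then [] else [p]) @ (b # q) # Q"
proof -
  have "drop_nodes (sum_list (map length R) + length p) (R @ (p @ q) # Q) = q # Q"
    using assms(2) by (induction R) auto
  moreover have "take_nodes (sum_list (map length R) + length p) (R @ (p @ q) # Q) =
      R @ (if p = [] then [] else [p])"
    using assms
  proof (induction R)
    case (Cons r R)
    show ?case
    proof (cases "sum_list (map length R) + length p = 0")
      case True
      with Cons.prems have "R = []" "p = []" by (cases R; simp)+
      with Cons.prems show ?thesis by simp
    next
      case False
      moreover from this have "\<not> (R = [] \<and> p = [])" by auto
      ultimately show ?thesis using Cons by (auto simp del: sum_list_eq_0_iff)
    qed
  qed (cases p; simp)
  ultimately show ?thesis by (simp add: insert_at_def glue_def)
qed

lemma split_composition:
  fixes \<alpha> :: "nat list"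
  assumes "p < sum_list \<alpha>"
  obtains \<alpha>1 m1 m2 \<alpha>2 where "\<alpha> = \<alpha>1 @ (m1 + m2) # \<alpha>2" "0 < m2" "p = sum_list \<alpha>1 + m1"
  using assms
proof (induction \<alpha> arbitrary: p thesis)
  case (Cons a \<alpha>)
  show ?case
  proof (cases "p < a")
    case True
    then show ?thesis by (intro Cons.prems(1)[of "[]" p "a - p" \<alpha>]) auto
  next
    case False
    with Cons.prems(2) have "p - a < sum_list \<alpha>" by simp
    then obtain \<alpha>1 m1 m2 \<alpha>2 where "\<alpha> = \<alpha>1 @ (m1 + m2) # \<alpha>2" "0 < m2" "p - a = sum_list \<alpha>1 + m1"
      using Cons.IH by blast
    with False show ?thesis by (intro Cons.prems(1)[of "a # \<alpha>1" m1 m2 \<alpha>2]) auto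
  qed
qed simp

lemma split_shape:
  assumes "map length T = \<alpha>1 @ (m1 + m2) # \<alpha>2"
  obtains R p q Q where "T = R @ (p @ q) # Q" "map length R = \<alpha>1" "length p = m1" "length q = m2"
    "map length Q = \<alpha>2"
proof -
  from assms obtain R r Q where T: "T = R @ r # Q" "map length R = \<alpha>1" "length r = m1 + m2" "map length Q = \<alpha>2"
    by (auto simp: map_eq_append_conv map_eq_Cons_conv)
  show thesis
    using T by (intro that[of R "take m1 r" "drop m1 r" Q]) auto
qed

lemma reading_word_simps:
  "reading_word [] = []" "reading_word (r # T) = rev r @ reading_word T"
  "reading_word (S @ T) = reading_word S @ reading_word T"
  by (simp_all add: reading_word_def)

lemma set_reading_word: "set (reading_word T) = (\<Union>r\<in>set T. set r)"
  by (auto simp: reading_word_def)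

lemma reading_word_inject:
  "reading_word S = reading_word T \<Longrightarrow> map length S = map length T \<Longrightarrow> S = T"
proof (induction S arbitrary: T)
  case (Cons r S)
  then show ?case by (cases T) (auto simp: reading_word_def)
qed simp

text \<open>
  For a tableau cut in the middle of a row, the two words below are \<open>w(T) b\<close> and \<open>w(b \<rightarrow> T)\<close>: \<open>P\<close> and
  \<open>Q\<close> are the reversed parts of the cut row, \<open>U\<close> and \<open>V\<close> the words of the rows above and below it.
  Unless \<open>b\<close> is \<open>i\<close> or \<open>i + 1/2\<close>, these letters occur on one side of \<open>b\<close> only, so that their order
  is the same in both words.
\<close>

lemma changes_to_insert:
  assumes len: "length U = length U'" "length P = length P'" "length Q = length Q'" "length V = length V'"
    and Q: "Q \<noteq> []"
    and before: "\<And>a. a \<in> set U \<union> set P \<Longrightarrow> col_rel a b"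
    and after: "\<And>a. a \<in> set Q \<Longrightarrow> row_rel b a"
    and QV: "\<And>a c. a \<in> set Q \<Longrightarrow> c \<in> set V \<Longrightarrow> col_rel a c"
    and x: "x \<in> {i, plus_half i}"
    and ch: "changes_to i x y (U @ Q @ P @ V @ [b]) (U' @ Q' @ P' @ V' @ [b'])"
  shows "changes_to i x y (U @ P @ Q @ [b] @ V) (U' @ P' @ Q' @ [b'] @ V')"
proof -
  let ?E = "{i, plus_half i}"
  \<comment> \<open>Any entry of \<open>Q\<close> links \<open>b\<close> to \<open>V\<close> by a
    row step followed by a column step, which is strict.\<close>
  have bV: "b < c" if "c \<in> set V" for c
    using that Q after QV row_col_less by (metis hd_in_set)
  have adj: "plus_half i < c \<longleftrightarrow> i < c \<and> c \<noteq> plus_half i" for c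
    using plus_half_le_iff[of i c] by (auto simp: le_less)
  \<comment> \<open>The case of an integer \<open>b = i\<close> is included because integers cannot
    repeat in a column; dually, the next step uses that non-integers cannot repeat in a row.\<close>
  have UP: "(set U \<union> set P) \<inter> ?E = {}" if "b < i \<or> b = i \<and> is_integer i"
  proof -
    have "a < i" if "a \<in> set U \<union> set P" for a
      using before[OF that] \<open>b < i \<or> b = i \<and> is_integer i\<close> by (auto simp: col_rel_def)
    then show ?thesis using less_plus_half[of i] by (fastforce dest: less_trans)
  qed
  have QV': "(set Q \<union> set V) \<inter> ?E = {}" if "plus_half i < b \<or> b = plus_half i \<and> \<not> is_integer (plus_half i)"
  proof -
    have "plus_half i < a" if "a \<in> set Q \<union> set V" for a
      using after[of a] bV[of a] that \<open>plus_half i < b \<or> _\<close> by (auto simp: row_rel_def)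
    then show ?thesis using less_plus_half[of i] by (fastforce dest: less_trans)
  qed
  have V: "set V \<inter> ?E = {}" if "b \<in> ?E" "\<not> is_integer i \<or> set Q \<inter> ?E = {}"
  proof -
    have "a > plus_half i \<or> a = plus_half i \<and> \<not> is_integer i" if "a \<in> set Q" for a
      using that after[OF that] \<open>b \<in> ?E\<close> \<open>\<not> is_integer i \<or> set Q \<inter> ?E = {}\<close> adj[of a]
      by (auto simp: row_rel_def)
    from this[of "hd Q"] have "plus_half i < hd Q \<or> hd Q = plus_half i \<and> \<not> is_integer i"
      using Q by simp
    then have "plus_half i < c" if "c \<in> set V" for c
      using QV[of "hd Q" c] that Q by (auto simp: col_rel_def dest: less_trans)
    then show ?thesis using less_plus_half[of i] by (fastforce dest: less_trans)
  qed
  have ends: "b < i \<or> b \<in> ?E \<or> plus_half i < b" using adj[of b] by auto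
  have len1: "length [b] = length [b']" by simp
  note app = changes_to_append[OF len(1)] changes_to_append[OF len(2)] changes_to_append[OF len(3)]
    changes_to_append[OF len(4)] changes_to_append[OF len1] set_append Int_Un_distrib2 Un_empty
    append_eq_append_conv[OF disjI1, OF len(1)] append_eq_append_conv[OF disjI1, OF len(2)]
    append_eq_append_conv[OF disjI1, OF len(3)] append_eq_append_conv[OF disjI1, OF len(4)]
    append_eq_append_conv[OF disjI1, OF len1]
  have mem: "\<not> changes_to i x y w w'" if "set w \<inter> ?E = {}" for w w'
    using that x changes_to_mem[of i x y w w'] by blast
  have b: "set [b] \<inter> ?E = {} \<longleftrightarrow> b \<notin> ?E" by auto
  \<comment> \<open>Compare the relevant letters in \<open>U Q P V b\<close> and
    \<open>U P Q b V\<close>. In \<open>early\<close> they lie in \<open>Q\<close> and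
    \<open>V\<close>, in \<open>late\<close> in \<open>U\<close>, \<open>P\<close> and
    \<open>b\<close>, with the same order in both words. In \<open>int\<close> the first one is in
    \<open>Q\<close> if possible and is \<open>b\<close> otherwise; in \<open>nonint\<close> the
    last one is \<open>b\<close>.\<close>
  consider
      (early) "b \<notin> ?E" "(set U \<union> set P) \<inter> ?E = {}"
    | (late) "(set Q \<union> set V) \<inter> ?E = {}"
    | (int) "b \<in> ?E" "is_integer i" "(set U \<union> set P) \<inter> ?E = {}" "set V \<inter> ?E = {} \<or> set Q \<inter> ?E \<noteq> {}"
    | (nonint) "b \<in> ?E" "\<not> is_integer i" "set V \<inter> ?E = {}"
  proof -
    from ends consider "b \<notin> ?E" "b < i \<or> plus_half i < b" | "b \<in> ?E" "\<not> is_integer i"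
      | "b = i" "is_integer i" | "b = plus_half i" "is_integer i" by auto
    then show thesis
    proof cases
      case 1
      then show thesis using early late UP QV' by blast
    next
      case 2
      then show thesis using nonint V by blast
    next
      case 3
      then show thesis using int UP V by blast
    next
      case 4
      then show thesis using late QV' by simp
    qed
  qed
  then show ?thesis
  proof cases
    case early
    then show ?thesis
      using ch mem[of U U'] mem[of P P'] mem[of Q Q'] mem[of V V'] mem[of "[b]" "[b']"] b
      unfolding app
      by (auto simp del: insert_disjoint disjoint_insert Int_insert_right Int_insert_left)
  next
    case late
    then show ?thesis
      using ch mem[of U U'] mem[of P P'] mem[of Q Q'] mem[of V V'] mem[of "[b]" "[b']"] b
      unfolding app
      by (auto simp del: insert_disjoint disjoint_insert Int_insert_right Int_insert_left)
  next
    case int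
    then show ?thesis
      using ch mem[of U U'] mem[of P P'] mem[of Q Q'] mem[of V V'] mem[of "[b]" "[b']"] b
      unfolding app
      by (auto simp del: insert_disjoint disjoint_insert Int_insert_right Int_insert_left)
  next
    case nonint
    then show ?thesis
      using ch mem[of U U'] mem[of P P'] mem[of Q Q'] mem[of V V'] mem[of "[b]" "[b']"] b
      unfolding app
      by (auto simp del: insert_disjoint disjoint_insert Int_insert_right Int_insert_left)
  qed
qed


text \<open>The cut depends only on \<alpha> and \<open>p\<close>, so all tableaux of one shape are
  cut into pieces of matching lengths and can be compared piece by piece.\<close>

lemma insert_at_cases:
  assumes "composition \<alpha>" "p \<le> sum_list \<alpha>"
  obtains (last) "p = sum_list \<alpha>" "\<And>T b. map length T = \<alpha> \<Longrightarrow> insert_at p b T = T @ [[b]]"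
    | (middle) \<alpha>1 m1 m2 \<alpha>2 where "p = sum_list \<alpha>1 + m1"
        "\<And>T. map length T = \<alpha> \<Longrightarrow> \<exists>R m q Q. T = R @ (m @ q) # Q \<and> map length R = \<alpha>1 \<and>
          length m = m1 \<and> length q = m2 \<and> map length Q = \<alpha>2 \<and> q \<noteq> [] \<and>
          (\<forall>b. insert_at p b T = R @ (if m = [] then [] else [m]) @ (b # q) # Q)"
proof (cases "p = sum_list \<alpha>")
  case True
  have "insert_at p b T = T @ [[b]]" if "map length T = \<alpha>" for T b
  proof -
    have "[] \<notin> set T" using assms(1) that by (auto simp: composition_def)
    then show ?thesis using insert_at_end that True by blast
  qed
  then show ?thesis by (rule last[OF True])
next
  case False
  with assms(2) have "p < sum_list \<alpha>" by simp
  then obtain \<alpha>1 m1 m2 \<alpha>2 where \<alpha>: "\<alpha> = \<alpha>1 @ (m1 + m2) # \<alpha>2" "0 < m2" "p = sum_list \<alpha>1 + m1"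
    by (rule split_composition)
  show ?thesis
  proof (rule middle[OF \<alpha>(3)])
    fix T :: tableau assume "map length T = \<alpha>"
    then obtain R m q Q where T: "T = R @ (m @ q) # Q" "map length R = \<alpha>1" "length m = m1"
      "length q = m2" "map length Q = \<alpha>2"
      using split_shape \<alpha>(1) by metis
    have "[] \<notin> set R" using assms(1) \<alpha>(1) T(2) by (auto simp: composition_def)
    then have "insert_at p b T = R @ (if m = [] then [] else [m]) @ (b # q) # Q" for b
      using insert_at_middle[of R q m b Q] \<alpha> T by auto
    with T \<alpha>(2) show "\<exists>R m q Q. T = R @ (m @ q) # Q \<and> map length R = \<alpha>1 \<and>
          length m = m1 \<and> length q = m2 \<and> map length Q = \<alpha>2 \<and> q \<noteq> [] \<and>
          (\<forall>b. insert_at p b T = R @ (if m = [] then [] else [m]) @ (b # q) # Q)"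
      by (intro exI[of _ R] exI[of _ m] exI[of _ q] exI[of _ Q]) auto
  qed
qed

section \<open>Gluing preserves weights, is injective and respects the operators\<close>

lemma sum_epsilon_insert_at:
  assumes "composition \<alpha>" "map length T = \<alpha>" "p \<le> sum_list \<alpha>"
  shows "sum_list (map epsilon (reading_word (insert_at p b T))) =
    sum_list (map epsilon (reading_word T)) + epsilon b"
  using assms(1,3)
proof (cases rule: insert_at_cases)
  case last
  with assms(2) show ?thesis by (simp add: reading_word_simps)
next
  case (middle \<alpha>1 m1 m2 \<alpha>2)
  with assms(2) obtain R m q Q where "T = R @ (m @ q) # Q"
    "insert_at p b T = R @ (if m = [] then [] else [m]) @ (b # q) # Q" by metis
  then show ?thesis by (simp add: reading_word_simps ac_simps)
qed

lemma insert_at_inject: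
  assumes "composition \<alpha>" "map length T = \<alpha>" "map length T' = \<alpha>" "p \<le> sum_list \<alpha>"
    and eq: "insert_at p b T = insert_at p b' T'"
  shows "T = T' \<and> b = b'"
  using assms(1,4)
proof (cases rule: insert_at_cases)
  case last
  with assms show ?thesis by simp
next
  case (middle \<alpha>1 m1 m2 \<alpha>2)
  obtain R m q Q where T: "T = R @ (m @ q) # Q" "map length R = \<alpha>1" "length m = m1"
    "insert_at p b T = R @ (if m = [] then [] else [m]) @ (b # q) # Q"
    using middle(2)[OF assms(2)] by blast
  obtain R' m' q' Q' where T': "T' = R' @ (m' @ q') # Q'" "map length R' = \<alpha>1" "length m' = m1"
    "insert_at p b' T' = R' @ (if m' = [] then [] else [m']) @ (b' # q') # Q'"
    using middle(2)[OF assms(3)] by blast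
  have "length R = length R'" using T(2) T'(2) by (metis length_map)
  moreover have "m = [] \<longleftrightarrow> m' = []" using T(3) T'(3) by auto
  ultimately show ?thesis using eq T(1,4) T'(1,4) by (auto split: if_splits)
qed

text \<open>Gives both the stability of the domain of \<open>\<Phi>\<close> and its compatibility
  with arrows. That the second glued filling is a tableau is not checked entry by entry but deduced
  from the stability of reading words.\<close>

lemma insert_at_changes_to:
  assumes T: "T \<in> quasi_ribbon_tableaux \<alpha>" "T' \<in> quasi_ribbon_tableaux \<alpha>" and p: "p \<le> sum_list \<alpha>"
    and S: "insert_at p b T \<in> quasi_ribbon_tableaux \<beta>"
    and ch: "changes_to i x y (reading_word T @ [b]) (reading_word T' @ [b'])"
    and xy: "(x, y) = (plus_half i, i) \<or> (x, y) = (i, plus_half i)"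
  shows "insert_at p b' T' \<in> quasi_ribbon_tableaux \<beta> \<and>
    changes_to i x y (reading_word (insert_at p b T)) (reading_word (insert_at p b' T'))"
proof -
  let ?S = "insert_at p b T" and ?S' = "insert_at p b' T'"
  from T have shape: "composition \<alpha>" "map length T = \<alpha>" "map length T' = \<alpha>"
    by (simp_all add: quasi_ribbon_tableaux_def)
  have main: "changes_to i x y (reading_word ?S) (reading_word ?S') \<and> map length ?S' = map length ?S"
    using shape(1) p
  proof (cases rule: insert_at_cases)
    \<comment> \<open>Here \<open>b\<close> forms a new last row, so \<open>w(T) b\<close> is
      already the word of the glued tableau.\<close>
    case last
    with shape ch show ?thesis by (simp add: reading_word_simps)
  next
    case (middle \<alpha>1 m1 m2 \<alpha>2)
    obtain R m q Q where R: "T = R @ (m @ q) # Q" "map length R = \<alpha>1" "length m = m1"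
      "length q = m2" "map length Q = \<alpha>2" "q \<noteq> []"
      "?S = R @ (if m = [] then [] else [m]) @ (b # q) # Q"
      using middle(2)[OF shape(2)] by blast
    obtain R' m' q' Q' where R': "T' = R' @ (m' @ q') # Q'" "map length R' = \<alpha>1" "length m' = m1"
      "length q' = m2" "map length Q' = \<alpha>2"
      "?S' = R' @ (if m' = [] then [] else [m']) @ (b' # q') # Q'"
      using middle(2)[OF shape(3)] by blast
    from S have rows: "sorted_wrt row_rel (b # q)"
      and cols: "sorted_wrt rows_below (R @ (if m = [] then [] else [m]) @ (b # q) # Q)"
      unfolding quasi_ribbon_tableaux_iff R(7) by simp_all
    have below: "rows_below r (b # q)" if "r \<in> set (R @ (if m = [] then [] else [m]))" for r
      using cols that unfolding append_assoc[symmetric] sorted_wrt_append by auto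
    have above: "rows_below (b # q) r" if "r \<in> set Q" for r
      using cols that by (simp add: sorted_wrt_append)
    have "changes_to i x y (reading_word R @ rev m @ rev q @ [b] @ reading_word Q)
       (reading_word R' @ rev m' @ rev q' @ [b'] @ reading_word Q')"
    proof (rule changes_to_insert)
      show "changes_to i x y (reading_word R @ rev q @ rev m @ reading_word Q @ [b])
        (reading_word R' @ rev q' @ rev m' @ reading_word Q' @ [b'])"
        using ch by (simp add: R(1) R'(1) reading_word_simps)
      show "col_rel a b" if a: "a \<in> set (reading_word R) \<union> set (rev m)" for a
      proof -
        from a obtain r where "r \<in> set (R @ (if m = [] then [] else [m]))" "a \<in> set r"
          by (cases "m = []") (auto simp: set_reading_word)
        with below[of r] show ?thesis by (simp add: rows_below_def)
      qed
      show "row_rel b a" if "a \<in> set (rev q)" for a using rows that by simp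
      show "col_rel a c" if "a \<in> set (rev q)" "c \<in> set (reading_word Q)" for a c
        using above that by (auto simp: rows_below_def set_reading_word)
      show "x \<in> {i, plus_half i}" using xy by auto
    qed (use R R' in \<open>simp_all add: length_reading_word\<close>)
    moreover have "m = [] \<longleftrightarrow> m' = []" using R(3) R'(3) by auto
    ultimately show ?thesis using R R' by (cases "m = []") (simp_all add: reading_word_simps)
  qed
  \<comment> \<open>The changed word belongs to some tableau of shape \<beta>; since word and row
    lengths determine a filling, it must be \<open>?S'\<close>.\<close>
  then obtain S' where S': "S' \<in> quasi_ribbon_tableaux \<beta>" "reading_word S' = reading_word ?S'"
    using reading_word_closed[OF S _ xy] by fastforce
  moreover have "map length S' = map length ?S'"
    using S S'(1) main by (simp add: quasi_ribbon_tableaux_def)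
  ultimately have "S' = ?S'" by (intro reading_word_inject)
  with S'(1) main show ?thesis by blast
qed

section \<open>The insertion point\<close>

text \<open>Positions refer to \<open>concat T\<close>, which follows the ribbon, not to the reading
  word. If nothing is bumped, the point is the number of nodes and the last claim is
  vacuous.\<close>

lemma insertion_point_props:
  shows "insertion_point b T \<le> length (concat T)"
    and "k < insertion_point b T \<Longrightarrow> col_rel (concat T ! k) b"
    and "insertion_point b T < length (concat T) \<Longrightarrow> row_rel b (concat T ! insertion_point b T)"
proof -
  let ?P = "\<lambda>k. k < length (concat T) \<and> bumps b (concat T ! k)"
  have ip: "insertion_point b T = (if \<exists>k. ?P k then LEAST k. ?P k else length (concat T))"
    by (simp add: insertion_point_def Let_def)
  have ex: "?P (LEAST k. ?P k)" if "\<exists>k. ?P k" using that by (rule LeastI_ex)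
  show le: "insertion_point b T \<le> length (concat T)" using ex unfolding ip by (auto simp: less_imp_le)
  show "col_rel (concat T ! k) b" if k: "k < insertion_point b T"
  proof -
    have "\<not> ?P k" using k not_less_Least[of k ?P] unfolding ip by (auto split: if_splits)
    with k le show ?thesis by (simp add: not_bumps_iff)
  qed
  show "row_rel b (concat T ! insertion_point b T)" if "insertion_point b T < length (concat T)"
    using that ex unfolding ip by (auto simp: bumps_iff split: if_splits)
qed

text \<open>Places the initial pair in the domain of \<open>\<Phi>\<close>. The relations of
  \<open>b\<close> to its neighbours extend to all pairs of rows by transitivity and by the
  strictness of mixed steps.\<close>

lemma insert_letter_quasi_ribbon:
  assumes T: "T \<in> quasi_ribbon_tableaux \<alpha>"
  shows "insert_letter b T \<in> quasi_ribbon_tableaux (shape (insert_letter b T))"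
proof -
  let ?p = "insertion_point b T" and ?S = "insert_letter b T"
  from T have comp: "composition \<alpha>" and len: "map length T = \<alpha>"
    and rows: "\<forall>r\<in>set T. sorted_wrt row_rel r" and cols: "sorted_wrt rows_below T"
    by (simp_all add: quasi_ribbon_tableaux_iff)
  have "?p \<le> sum_list \<alpha>"
    using insertion_point_props(1)[of b T] len by (simp add: length_concat)
  with comp show ?thesis
  proof (cases rule: insert_at_cases)
    case last
    then have S: "?S = T @ [[b]]" using len by (simp add: insert_letter_eq)
    have "col_rel a b" if "a \<in> set (concat T)" for a
    proof -
      have "?p = length (concat T)" using last(1) len by (simp add: length_concat)
      with that insertion_point_props(2)[of _ b T] show ?thesis by (metis in_set_conv_nth)
    qed
    then have "rows_below r [b]" if "r \<in> set T" for r using that by (auto simp: rows_below_def)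
    with comp len rows cols show ?thesis
      by (auto simp: S quasi_ribbon_tableaux_iff shape_def composition_def sorted_wrt_append)
  next
    case (middle \<alpha>1 m1 m2 \<alpha>2)
    obtain R m q Q where R: "T = R @ (m @ q) # Q" "map length R = \<alpha>1" "length m = m1" "q \<noteq> []"
      "?S = R @ (if m = [] then [] else [m]) @ (b # q) # Q"
      using middle(2)[OF len] unfolding insert_letter_eq by blast
    have p: "?p = length (concat R @ m)" using middle(1) R(2,3) by (simp add: length_concat)
    have t: "concat T = (concat R @ m) @ q @ concat Q" using R(1) by simp
    have before: "col_rel a b" if a: "a \<in> set (concat R @ m)" for a
    proof -
      obtain k where "k < ?p" "(concat R @ m) ! k = a" using a p by (metis in_set_conv_nth)
      with insertion_point_props(2)[of k b T] show ?thesis by (simp only: t p nth_append_left)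
    qed
    have "?p < length (concat T)" "concat T ! ?p = hd q"
      using R(4) by (auto simp: p t nth_append hd_conv_nth simp del: concat_append)
    with insertion_point_props(3)[of b T] have hd: "row_rel b (hd q)" by simp
    have mq: "sorted_wrt row_rel (m @ q)" and RQ: "sorted_wrt rows_below (R @ (m @ q) # Q)"
      using rows cols R(1) by simp_all
    have after: "row_rel b a" if "a \<in> set q" for a
    proof -
      have "a = hd q \<or> row_rel (hd q) a" using that mq by (cases q) (auto simp: sorted_wrt_append)
      with hd row_rel_trans show ?thesis by blast
    qed
    have bQ: "col_rel b c" if "c \<in> set r" "r \<in> set Q" for c r
      using row_col_less[OF hd, of c] R(4) RQ that
      by (auto simp: sorted_wrt_append rows_below_def col_rel_def)
    \<comment> \<open>The two halves of the cut row end up in different rows, so their row relation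
      must become a column relation; passing through \<open>b\<close> makes it strict.\<close>
    have mqc: "col_rel a c" if "a \<in> set m" "c \<in> set q" for a c
      using col_row_less[OF before after] that by (auto simp: col_rel_def)
    have RQ': "sorted_wrt rows_below R" "sorted_wrt rows_below Q"
      "\<And>r s. r \<in> set R \<Longrightarrow> s \<in> set Q \<Longrightarrow> rows_below r s"
      "\<And>r. r \<in> set R \<Longrightarrow> rows_below r (m @ q)" "\<And>s. s \<in> set Q \<Longrightarrow> rows_below (m @ q) s"
      using RQ by (simp_all add: sorted_wrt_append)
    have "rows_below r m" "rows_below r (b # q)" if "r \<in> set R" for r
      using RQ'(4)[OF that] before that by (auto simp: rows_below_def)
    moreover have "rows_below m s" "rows_below (b # q) s" if "s \<in> set Q" for s
      using RQ'(5)[OF that] bQ that by (auto simp: rows_below_def)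
    moreover have "rows_below m (b # q)"
      using before mqc by (auto simp: rows_below_def)
    ultimately have "sorted_wrt rows_below ?S"
      unfolding R(5) using RQ'(1-3) by (simp add: sorted_wrt_append)
    moreover have "\<forall>r\<in>set ?S. sorted_wrt row_rel r"
      unfolding R(5) using mq after rows R(1) by (auto simp: sorted_wrt_append)
    moreover have "composition (shape ?S)"
      using comp unfolding len[symmetric] shape_def composition_map_length_iff R(5) by (auto simp: R(1))
    ultimately show ?thesis by (simp add: quasi_ribbon_tableaux_iff shape_def)
  qed
qed

theorem lemma3p3:
  fixes \<alpha> :: "nat list" and T :: tableau and b :: pos_half
  assumes "composition \<alpha>"
    and "T \<in> vertices (tableau_crystal \<alpha>)"
  shows "gl_equiv (tableau_crystal (shape (insert_letter b T))) (insert_letter b T)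
                  (tensor (tableau_crystal \<alpha>) letter_crystal) (T, b)"
proof -
  from assms(2) have T: "T \<in> quasi_ribbon_tableaux \<alpha>" by (simp add: vertices_tableau_crystal)
  define p where "p = insertion_point b T"
  define \<Phi> where "\<Phi> = (\<lambda>(T, b). insert_at p b T)"
  let ?\<beta> = "shape (insert_letter b T)"
  \<comment> \<open>Membership is tested on the tableau glued at the fixed \<open>p\<close>, so no
    insertion point has to be recomputed after an operator is applied.\<close>
  let ?A = "{a. fst a \<in> quasi_ribbon_tableaux \<alpha> \<and> \<Phi> a \<in> quasi_ribbon_tableaux ?\<beta>}"
  let ?B1 = "tableau_crystal ?\<beta>" and ?B2 = "tensor (tableau_crystal \<alpha>) letter_crystal"
  have p: "p \<le> sum_list \<alpha>"
    using insertion_point_props(1)[of b T] T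
    by (simp add: p_def length_concat quasi_ribbon_tableaux_def)
  have eq: "insert_letter b T = \<Phi> (T, b)" by (simp add: \<Phi>_def p_def insert_letter_eq)
  have len: "map length S = \<alpha>" if "S \<in> quasi_ribbon_tableaux \<alpha>" for S
    using that by (simp add: quasi_ribbon_tableaux_def)
  have "gl_equiv ?B1 (\<Phi> (T, b)) ?B2 (T, b)"
  proof (rule gl_equiv_embedding[where A = ?A])
    show "inj_on \<Phi> ?A"
      using insert_at_inject[OF assms(1) len len p] by (fastforce simp: \<Phi>_def intro: inj_onI)
    show "wt ?B1 (\<Phi> a) = wt ?B2 a" if "a \<in> ?A" for a
      using that sum_epsilon_insert_at[OF assms(1) len p]
      by (cases a) (simp add: wt_tableau tensor_def letter_crystal_def \<Phi>_def)
    show "?A \<subseteq> vertices ?B2"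
      by (auto simp: vertices_tableau_crystal tensor_def letter_crystal_def)
    show "(T, b) \<in> ?A" using T insert_letter_quasi_ribbon[OF T, of b] by (simp add: eq)
    fix i and a a' :: "tableau \<times> pos_half" assume a: "a \<in> ?A"
    obtain S c S' c' where a_eq: "a = (S, c)" "a' = (S', c')" by (metis surj_pair)
    have S: "S \<in> quasi_ribbon_tableaux \<alpha>" "insert_at p c S \<in> quasi_ribbon_tableaux ?\<beta>"
      using a by (simp_all add: a_eq \<Phi>_def)
    note step = insert_at_changes_to[OF S(1) _ p S(2)]
    show "a' \<in> ?A \<and> e_op ?B1 i (\<Phi> a) = Some (\<Phi> a')" if "e_op ?B2 i a = Some a'"
      using e_f_tableau_tensor_letter(1)[OF S(1) that[unfolded a_eq]] step[of S' i "plus_half i" i c']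
      by (simp add: a_eq \<Phi>_def e_f_tableau_iff(1)[OF S(2)])
    show "a' \<in> ?A \<and> f_op ?B1 i (\<Phi> a) = Some (\<Phi> a')" if "f_op ?B2 i a = Some a'"
      using e_f_tableau_tensor_letter(2)[OF S(1) that[unfolded a_eq]] step[of S' i i "plus_half i" c']
      by (simp add: a_eq \<Phi>_def e_f_tableau_iff(2)[OF S(2)])
  qed (auto simp: gl_crystal_tableau gl_crystal_tableau_tensor_letter seminormal_tableau seminormal_tensor
      seminormal_letter vertices_tableau_crystal)
  then show ?thesis by (simp add: eq)
qed

end
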